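(* For $|q|<1$, $$\sum_{m,k\geq0}\frac{q^{T(m)+T(m+k)}\,(-q;q^2)_{\lfloor k/2\rfloor}}{(q)_m(q)_k}=\frac{(q^{20},q^8,q^{12};q^{20})_\infty}{(q)_\infty}.$$
   Context: For $m$ a nonnegative integer, $(a;q)_m=\prod_{j=0}^{m-1}(1-aq^j)$ (with $(a;q)_0=1$), $(a;q)_\infty=\prod_{j\ge0}(1-aq^j)$, and $(a_1,\ldots,a_r;q)_\infty=(a_1;q)_\infty\cdots(a_r;q)_\infty$. In particular $(q)_m=(q;q)_m=\prod_{j=1}^m(1-q^j)$, $(q)_\infty=(q;q)_\infty$, and $(-q;q^2)_m=\prod_{j=0}^{m-1}(1+q^{2j+1})$. $T(j)=\frac{j(j+1)}{2}$. *)

theory Defs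
  imports "HOL-Analysis.Analysis"
begin

definition qpoch :: "complex \<Rightarrow> complex \<Rightarrow> nat \<Rightarrow> complex" where
  "qpoch a q m = (\<Prod>j<m. 1 - a * q ^ j)"

definition qpoch_inf :: "complex \<Rightarrow> complex \<Rightarrow> complex" where
  "qpoch_inf a q = (\<Prod>j. 1 - a * q ^ j)"

definition qpoch_inf_list :: "complex list \<Rightarrow> complex \<Rightarrow> complex" where
  "qpoch_inf_list as q = (\<Prod>a\<leftarrow>as. qpoch_inf a q)"

(* The division is exact, so natural-number div loses nothing. *)
definition T :: "nat \<Rightarrow> nat" where
  "T j = j * (j + 1) div 2"

end

theory Submission
  imports Defs
begin

text \<open>
  Write \<open>c\<^sub>k = (-q;q\<^sup>2)\<^bsub>\<lfloor>k/2\<rfloor>\<^esub>\<close> and collect the terms with \<open>m + k = N\<close>. The inner sums are the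
  coefficients of \<open>(-xq;q)\<^sub>\<infinity> (E(x) + O(x))\<close>, where \<open>E\<close> and \<open>O\<close> are the even and odd parts of
  \<open>\<Sum> c\<^sub>k x\<^sup>k / (q)\<^sub>k\<close>. They satisfy \<open>O(x) - O(xq) = x E(x)\<close> and \<open>E(x) - E(xq) = x (O(x) + O(xq))\<close>, so
  \<open>(x\<^sup>2;q\<^sup>2)\<^sub>\<infinity> O(x)\<close> satisfies a q-difference equation that yields a two-term recurrence for its
  coefficients. This gives a second expression for the inner sums as a convolution with
  \<open>1/(x;q)\<^sub>\<infinity>\<close>; after Euler's theorem the double sum becomes, with \<open>Q = q\<^sup>2\<close>,
  \<open>(-q;q)\<^sub>\<infinity>\<close> times \<open>\<Sum> Q\<^bsup>n(3n+1)/2\<^esup> (-Q;Q)\<^sub>n / (Q;Q)\<^bsub>2n+1\<^esub>\<close>. The summand comes from a Bailey pair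
  relative to \<open>a = q\<close> whose \<open>\<alpha>\<close> lives on even indices, so the sum equals
  \<open>\<Sum> (-1)\<^sup>i Q\<^bsup>i(5i+1)\<^esup> / (Q;Q)\<^sub>\<infinity>\<close> over the integers, which the Jacobi triple product evaluates.
\<close>

section \<open>Rewriting the inner convolution by a q-difference equation\<close>

lemma T_0 [simp]: "T 0 = 0"
  by (simp add: T_def)

lemma T_Suc: "T (Suc n) = T n + Suc n"
  by (simp add: T_def)

lemma qpoch_0 [simp]: "qpoch a q 0 = 1"
  by (simp add: qpoch_def)

lemma qpoch_Suc: "qpoch a q (Suc n) = qpoch a q n * (1 - a * q ^ n)"
  by (simp add: qpoch_def)

lemma qpoch_self_Suc: "qpoch q q (Suc n) = qpoch q q n * (1 - q ^ Suc n)"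
  by (simp add: qpoch_Suc)

lemma one_minus_power_nonzero:
  fixes q :: complex
  assumes "norm q < 1" "n > 0"
  shows "1 - q ^ n \<noteq> 0"
proof
  assume "1 - q ^ n = 0"
  then have "norm (q ^ n) = 1" by simp
  moreover have "norm (q ^ n) < 1"
    using assms by (simp add: norm_power power_less_one_iff)
  ultimately show False by simp
qed

lemma qpoch_self_nonzero:
  assumes "norm q < 1"
  shows "qpoch q q n \<noteq> 0"
  using one_minus_power_nonzero[OF assms, of "Suc _"]
  by (induction n) (simp_all add: qpoch_self_Suc del: power_Suc)

section \<open>The dilation f(x) -> f(qx) of formal power series\<close>

definition fps_dilate :: "complex \<Rightarrow> complex fps \<Rightarrow> complex fps" where
  "fps_dilate q f = Abs_fps (\<lambda>n. q ^ n * fps_nth f n)"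

lemma fps_dilate_nth [simp]: "fps_nth (fps_dilate q f) n = q ^ n * fps_nth f n"
  by (simp add: fps_dilate_def)

lemma fps_dilate_add: "fps_dilate q (f + g) = fps_dilate q f + fps_dilate q g"
  by (rule fps_ext) (simp add: algebra_simps)

lemma fps_dilate_diff: "fps_dilate q (f - g) = fps_dilate q f - fps_dilate q g"
  by (rule fps_ext) (simp add: algebra_simps)

lemma fps_dilate_mult: "fps_dilate q (f * g) = fps_dilate q f * fps_dilate q g"
proof (rule fps_ext)
  fix n
  have "q ^ n * (\<Sum>i=0..n. fps_nth f i * fps_nth g (n - i))
      = (\<Sum>i=0..n. (q ^ i * fps_nth f i) * (q ^ (n - i) * fps_nth g (n - i)))"
    unfolding sum_distrib_left
  proof (rule sum.cong)
    fix i assume "i \<in> {0..n}"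
    then have "q ^ n = q ^ i * q ^ (n - i)"
      by (simp flip: power_add)
    then show "q ^ n * (fps_nth f i * fps_nth g (n - i))
        = (q ^ i * fps_nth f i) * (q ^ (n - i) * fps_nth g (n - i))"
      by simp
  qed simp
  then show "fps_nth (fps_dilate q (f * g)) n = fps_nth (fps_dilate q f * fps_dilate q g) n"
    by (simp add: fps_mult_nth)
qed

lemma fps_dilate_1 [simp]: "fps_dilate q 1 = 1"
  by (rule fps_ext) simp

lemma fps_dilate_const [simp]: "fps_dilate q (fps_const c) = fps_const c"
  by (rule fps_ext) simp

lemma fps_dilate_X [simp]: "fps_dilate q fps_X = fps_const q * fps_X"
  by (rule fps_ext) (auto simp: fps_X_def)

text \<open>As a product this is \<open>(-cxq;q)\<^sub>\<infinity>\<close>, while \<open>qgeom_fps\<close> is \<open>1/(x;q)\<^sub>\<infinity>\<close>.\<close>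

definition qexp_fps :: "complex \<Rightarrow> complex \<Rightarrow> complex fps" where
  "qexp_fps q c = Abs_fps (\<lambda>n. c ^ n * q ^ T n / qpoch q q n)"

definition qgeom_fps :: "complex \<Rightarrow> complex fps" where
  "qgeom_fps q = Abs_fps (\<lambda>n. 1 / qpoch q q n)"

definition odd_fps :: "complex \<Rightarrow> complex fps" where
  "odd_fps q = Abs_fps (\<lambda>n. if odd n then qpoch (- q) (q ^ 2) (n div 2) / qpoch q q n else 0)"

definition even_fps :: "complex \<Rightarrow> complex fps" where
  "even_fps q = Abs_fps (\<lambda>n. if even n then qpoch (- q) (q ^ 2) (n div 2) / qpoch q q n else 0)"

text \<open>The coefficients of \<open>(x;q)\<^sub>\<infinity> (-xq;q)\<^sub>\<infinity> (E(x) + O(x))\<close>.\<close>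

definition lowered_coeff :: "complex \<Rightarrow> nat \<Rightarrow> complex" where
  "lowered_coeff q n = q ^ ((n div 2) ^ 2 + (if odd n then n else 0)) *
     qpoch (- (q ^ 2)) (q ^ 2) (n div 2) / qpoch q q n"

section \<open>q-difference equations of the product series\<close>

context
  fixes q :: complex
  assumes q: "norm q < 1"
begin

lemma div_qpoch_self_Suc:
  "x / qpoch q q (Suc n) * (1 - q ^ Suc n) = x / qpoch q q n"
  using one_minus_power_nonzero[OF q, of "Suc n"] by (simp add: qpoch_self_Suc)

lemma fps_nth_diff_dilate:
  "fps_nth (f - fps_dilate q f) n = (1 - q ^ n) * fps_nth f n"
  by (simp add: algebra_simps)

text \<open>The series form of (-cxq;q)_inf = (1 + cxq) (-cxq^2;q)_inf. Coefficients agree because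
  T(n+1) = T(n) + n + 1 and 1 - q^n cancels the last factor of (q)_n.\<close>

lemma qexp_fps_eq:
  "qexp_fps q c = (1 + fps_const (c * q) * fps_X) * fps_dilate q (qexp_fps q c)"
proof -
  have "fps_nth (qexp_fps q c - fps_dilate q (qexp_fps q c)) n
      = fps_nth (fps_const (c * q) * fps_X * fps_dilate q (qexp_fps q c)) n" for n
  proof (cases n)
    case (Suc k)
    have "(1 - q ^ n) * fps_nth (qexp_fps q c) n = c ^ n * q ^ T n / qpoch q q n * (1 - q ^ n)"
      by (simp add: qexp_fps_def)
    also have "\<dots> = c ^ n * q ^ T n / qpoch q q k"
      unfolding Suc by (rule div_qpoch_self_Suc)
    finally show ?thesis
      unfolding fps_nth_diff_dilate using Suc
      by (simp add: mult.assoc qexp_fps_def T_Suc power_add algebra_simps)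
  qed (simp add: qexp_fps_def mult.assoc)
  then have "qexp_fps q c - fps_dilate q (qexp_fps q c)
      = fps_const (c * q) * fps_X * fps_dilate q (qexp_fps q c)"
    by (rule fps_ext)
  then show ?thesis
    by (simp add: algebra_simps)
qed

text \<open>The full product (-cx;q)_inf also contains the factor 1 + cx; dilation removes exactly
  this factor.\<close>

lemma dilate_full_qexp:
  "fps_dilate q ((1 + fps_const c * fps_X) * qexp_fps q c) = qexp_fps q c"
  by (subst (2) qexp_fps_eq)
     (simp add: fps_dilate_mult fps_dilate_add mult.assoc[symmetric] del: fps_const_mult
        add: fps_const_mult[symmetric])

lemma dilate_qgeom: "fps_dilate q (qgeom_fps q) = (1 - fps_X) * qgeom_fps q"
proof -
  have "fps_nth (qgeom_fps q - fps_dilate q (qgeom_fps q)) n = fps_nth (fps_X * qgeom_fps q) n" for n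
  proof (cases n)
    case (Suc k)
    then show ?thesis
      unfolding fps_nth_diff_dilate using div_qpoch_self_Suc[of 1 k]
      by (simp add: qgeom_fps_def mult.commute)
  qed (simp add: qgeom_fps_def)
  then have "qgeom_fps q - fps_dilate q (qgeom_fps q) = fps_X * qgeom_fps q"
    by (rule fps_ext)
  then show ?thesis
    by (simp add: algebra_simps)
qed

text \<open>Comparing coefficients gives (1 - q^n) f_n = 0, and q^n = 1 is impossible for n >
  0.\<close>

lemma fps_dilate_fixed:
  assumes "fps_dilate q f = f"
  shows "f = fps_const (fps_nth f 0)"
proof (rule fps_ext)
  fix n
  have "(1 - q ^ n) * fps_nth f n = 0"
    using arg_cong[OF assms, of "\<lambda>f. fps_nth f n"] by (simp add: algebra_simps)
  then show "fps_nth f n = fps_nth (fps_const (fps_nth f 0)) n"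
    using one_minus_power_nonzero[OF q, of n] by auto
qed

text \<open>Dilation multiplies 1/(x;q)_inf by 1 - x and removes the factor 1 - x from (x;q)_inf.
  Hence the product is fixed by dilation and equals its constant term.\<close>

lemma qgeom_inverse:
  "qgeom_fps q * ((1 - fps_X) * qexp_fps q (- 1)) = 1"
proof -
  define f where "f = qgeom_fps q * ((1 - fps_X) * qexp_fps q (- 1))"
  have "fps_dilate q ((1 - fps_X) * qexp_fps q (- 1)) = qexp_fps q (- 1)"
    using dilate_full_qexp[of "- 1"] by (simp flip: fps_const_neg)
  then have "fps_dilate q f = f"
    unfolding f_def fps_dilate_mult[of q "qgeom_fps q"] dilate_qgeom by (simp add: mult_ac)
  then have "f = fps_const (fps_nth f 0)"
    by (rule fps_dilate_fixed)
  also have "fps_nth f 0 = 1"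
    by (simp add: f_def qgeom_fps_def qexp_fps_def T_def)
  finally show ?thesis
    by (simp add: f_def)
qed

section \<open>Second-order equation for the odd part\<close>

lemma odd_fps_diff: "odd_fps q - fps_dilate q (odd_fps q) = fps_X * even_fps q"
proof (rule fps_ext)
  fix n
  show "fps_nth (odd_fps q - fps_dilate q (odd_fps q)) n = fps_nth (fps_X * even_fps q) n"
  proof (cases n)
    case (Suc k)
    then show ?thesis
      unfolding fps_nth_diff_dilate
      using div_qpoch_self_Suc[of "qpoch (- q) (q ^ 2) (k div 2)" k]
      by (auto simp: odd_fps_def even_fps_def mult.commute)
  qed (simp add: odd_fps_def)
qed

text \<open>Passing from odd k to k + 1 multiplies (-q;q^2) by the new factor 1 + q^k; its two
  summands produce O(x) and O(xq). From even k to k + 1 no factor is added, which gives the simpler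
  \<open>odd_fps_diff\<close>.\<close>

lemma even_fps_diff:
  "even_fps q - fps_dilate q (even_fps q) = fps_X * (odd_fps q + fps_dilate q (odd_fps q))"
proof (rule fps_ext)
  fix n
  show "fps_nth (even_fps q - fps_dilate q (even_fps q)) n
      = fps_nth (fps_X * (odd_fps q + fps_dilate q (odd_fps q))) n"
  proof (cases n)
    case (Suc k)
    show ?thesis
    proof (cases "odd k")
      case True
      then obtain j where k: "k = 2 * j + 1"
        by (elim oddE)
      have "(1 - q ^ Suc k) * (qpoch (- q) (q ^ 2) (Suc j) / qpoch q q (Suc k))
          = qpoch (- q) (q ^ 2) (Suc j) / qpoch q q k"
        using div_qpoch_self_Suc[of "qpoch (- q) (q ^ 2) (Suc j)" k] by (simp only: mult.commute)
      also have "\<dots> = (1 + q ^ k) * (qpoch (- q) (q ^ 2) j / qpoch q q k)"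
        by (simp add: qpoch_Suc k algebra_simps flip: power_mult)
      finally show ?thesis
        unfolding fps_nth_diff_dilate using Suc True k
        by (simp add: odd_fps_def even_fps_def algebra_simps add_divide_distrib)
    qed (use Suc in \<open>simp add: odd_fps_def even_fps_def\<close>)
  qed (simp add: even_fps_def)
qed

text \<open>Elimination of E: q times the equation for O minus its dilate contains E only through
  E(x) - E(xq), which \<open>even_fps_diff\<close> expresses by O.\<close>

lemma odd_fps_second_order:
  "fps_const q * (1 - fps_X ^ 2) * odd_fps q
     - (1 + fps_const q + fps_const q * fps_X ^ 2) * fps_dilate q (odd_fps q)
     + fps_dilate q (fps_dilate q (odd_fps q)) = 0"
proof -
  let ?D = "fps_dilate q" and ?O = "odd_fps q" and ?E = "even_fps q" and ?c = "fps_const q"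
  have 1: "?O - ?D ?O = fps_X * ?E"
    by (rule odd_fps_diff)
  have 2: "?D ?O - ?D (?D ?O) = ?c * fps_X * ?D ?E"
    using arg_cong[OF 1, of ?D] by (simp add: fps_dilate_diff fps_dilate_mult)
  have 3: "?E - ?D ?E = fps_X * (?O + ?D ?O)"
    by (rule even_fps_diff)
  have "?c * (?O - ?D ?O) - (?D ?O - ?D (?D ?O)) = ?c * fps_X * (?E - ?D ?E)"
    unfolding 1 2 by (simp add: algebra_simps)
  also have "\<dots> = ?c * fps_X ^ 2 * (?O + ?D ?O)"
    unfolding 3 by (simp add: power2_eq_square mult_ac)
  finally show ?thesis
    by (simp add: algebra_simps)
qed

text \<open>This is \<open>(x;q)\<^sub>\<infinity> (-x;q)\<^sub>\<infinity> O(x) = (x\<^sup>2;q\<^sup>2)\<^sub>\<infinity> O(x)\<close>.\<close>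

definition weighted_odd_fps :: "complex fps" where
  "weighted_odd_fps = ((1 - fps_X) * qexp_fps q (- 1)) * ((1 + fps_X) * qexp_fps q 1) * odd_fps q"

lemma dilate_qexp_plus: "fps_dilate q ((1 + fps_X) * qexp_fps q 1) = qexp_fps q 1"
  using dilate_full_qexp[of 1] by simp

lemma dilate_qexp_minus: "fps_dilate q ((1 - fps_X) * qexp_fps q (- 1)) = qexp_fps q (- 1)"
  using dilate_full_qexp[of "- 1"] by (simp flip: fps_const_neg)

text \<open>The weight absorbs 1 - x^2 in front of O(x) and moves a factor 1 - q^2 x^2 to the twice
  dilated term. For the coefficients this replaces q (1 + q^n) in the recurrence by q^(n+1) (1 +
  q^(n+1)), the source of the powers q^(j^2) and of (-q^2;q^2)_j.\<close>

lemma weighted_odd_second_order: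
  "fps_const q * weighted_odd_fps
     - (1 + fps_const q + fps_const q * fps_X ^ 2) * fps_dilate q weighted_odd_fps
     + (1 - fps_const (q ^ 2) * fps_X ^ 2) * fps_dilate q (fps_dilate q weighted_odd_fps) = 0"
proof -
  let ?D = "fps_dilate q" and ?O = "odd_fps q" and ?c = "fps_const q"
  define A B where "A = qexp_fps q (- 1)" and "B = qexp_fps q 1"
  have A: "A = (1 - ?c * fps_X) * ?D A"
    using qexp_fps_eq[of "- 1"] by (simp add: A_def flip: fps_const_neg)
  have B: "B = (1 + ?c * fps_X) * ?D B"
    using qexp_fps_eq[of 1] by (simp add: B_def)
  have U: "weighted_odd_fps = (1 - fps_X ^ 2) * (A * B) * ?O"
    by (simp add: weighted_odd_fps_def A_def B_def power2_eq_square algebra_simps)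
  have DU: "?D weighted_odd_fps = A * B * ?D ?O"
    unfolding weighted_odd_fps_def fps_dilate_mult[of q _ ?O] fps_dilate_mult[of q "_ * qexp_fps q (- 1)"]
      dilate_qexp_plus dilate_qexp_minus by (simp add: A_def B_def)
  have AB: "(1 - fps_const (q ^ 2) * fps_X ^ 2) * ?D (A * B) = A * B"
  proof -
    have "A * B = ((1 - ?c * fps_X) * (1 + ?c * fps_X)) * (?D A * ?D B)"
      by (subst A, subst B) (simp only: mult_ac)
    also have "(1 - ?c * fps_X) * (1 + ?c * fps_X) = 1 - fps_const (q ^ 2) * fps_X ^ 2"
      by (simp add: power2_eq_square algebra_simps flip: fps_const_mult)
    finally show ?thesis
      unfolding fps_dilate_mult by (rule sym)
  qed
  have DDU: "(1 - fps_const (q ^ 2) * fps_X ^ 2) * ?D (?D weighted_odd_fps) = A * B * ?D (?D ?O)"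
    unfolding DU fps_dilate_mult[of q "A * B"] mult.assoc[symmetric] AB ..
  have "?c * weighted_odd_fps - (1 + ?c + ?c * fps_X ^ 2) * (A * B * ?D ?O) + A * B * ?D (?D ?O)
      = A * B * (?c * (1 - fps_X ^ 2) * ?O - (1 + ?c + ?c * fps_X ^ 2) * ?D ?O + ?D (?D ?O))"
    unfolding U by (simp add: algebra_simps)
  also have "\<dots> = 0"
    unfolding odd_fps_second_order by simp
  finally show ?thesis
    unfolding DDU unfolding DU .
qed

text \<open>With N = n + 2, the three operators contribute q - (1 + q) q^N + q^(2N) = (q - q^N) (1 -
  q^N) at index N.\<close>

lemma weighted_odd_recurrence:
  "(q - q ^ Suc (Suc n)) * (1 - q ^ Suc (Suc n)) * fps_nth weighted_odd_fps (Suc (Suc n))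
     = q ^ Suc n * (1 + q ^ Suc n) * fps_nth weighted_odd_fps n"
  using arg_cong[OF weighted_odd_second_order, of "\<lambda>f. fps_nth f (Suc (Suc n))"]
  by (simp add: ring_distribs mult.assoc fps_X_power_mult_nth power2_eq_square)
     (simp add: algebra_simps)

lemma weighted_odd_nth:
  assumes "q \<noteq> 0"
  shows "fps_nth weighted_odd_fps n =
    (if odd n then q ^ ((n div 2) ^ 2) * qpoch (- (q ^ 2)) (q ^ 2) (n div 2) / qpoch q q n else 0)"
proof (induction n rule: less_induct)
  case (less n)
  consider "n = 0" | "n = 1" | k where "n = Suc (Suc k)"
    by (metis One_nat_def old.nat.exhaust)
  then show ?case
  proof cases
    case 1
    then show ?thesis
      by (simp add: weighted_odd_fps_def odd_fps_def)
  next
    case 2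
    then show ?thesis
      by (simp add: weighted_odd_fps_def odd_fps_def fps_mult_nth_1 qexp_fps_def T_def)
  next
    case (3 k)
    \<comment> \<open>The recurrence determines the new coefficient only if both factors are
      nonzero; q - q^n = q (1 - q^(n-1)) requires q to be nonzero.\<close>
    have nz: "(q - q ^ n) \<noteq> 0" "1 - q ^ n \<noteq> 0"
      using one_minus_power_nonzero[OF q, of "Suc k"] one_minus_power_nonzero[OF q, of n] 3 assms
      by auto
    note rec = weighted_odd_recurrence[of k, folded 3]
    show ?thesis
    proof (cases "odd k")
      case False
      then show ?thesis
        using rec less[of k] 3 nz by simp
    next
      case True
      then obtain j where k: "k = 2 * j + 1"
        by (elim oddE)
      \<comment> \<open>\<open>r\<close> is the claimed value. It is shown to satisfy the same
        recurrence step as the true coefficient, after which the nonzero factors cancel.\<close>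
      define r where "r = q ^ ((Suc j)^2) * qpoch (- (q ^ 2)) (q ^ 2) (Suc j) / qpoch q q n"
      have "(1 - q ^ n) * r = q ^ ((Suc j)^2) * qpoch (- (q ^ 2)) (q ^ 2) (Suc j) / qpoch q q (Suc k)"
        unfolding r_def 3 by (subst mult.commute) (rule div_qpoch_self_Suc)
      moreover have "q - q ^ n = q * (1 - q ^ Suc k)"
        by (simp add: 3 algebra_simps)
      ultimately have "(q - q ^ n) * (1 - q ^ n) * r
          = q * ((q ^ ((Suc j)^2) * qpoch (- (q ^ 2)) (q ^ 2) (Suc j) / qpoch q q (Suc k)) * (1 - q ^ Suc k))"
        by (metis mult.assoc mult.commute)
      also have "\<dots> = q * (q ^ ((Suc j)^2) * qpoch (- (q ^ 2)) (q ^ 2) (Suc j) / qpoch q q k)"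
        by (simp only: div_qpoch_self_Suc)
      also have "\<dots> = q ^ Suc k * (1 + q ^ Suc k) * (q ^ (j ^ 2) * qpoch (- (q ^ 2)) (q ^ 2) j / qpoch q q k)"
      proof -
        have "q * q ^ ((Suc j)^2) = q ^ Suc k * q ^ (j ^ 2)"
        proof -
          have "Suc ((Suc j)^2) = Suc k + j ^ 2"
            by (simp add: k power2_eq_square)
          then show ?thesis
            by (metis power_Suc power_add)
        qed
        moreover have "qpoch (- (q ^ 2)) (q ^ 2) (Suc j) = qpoch (- (q ^ 2)) (q ^ 2) j * (1 + q ^ Suc k)"
          by (simp add: qpoch_Suc k power2_eq_square power_mult flip: power_mult_distrib)
        ultimately have "q * q ^ ((Suc j)^2) * (qpoch (- (q ^ 2)) (q ^ 2) (Suc j) / qpoch q q k)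
            = q ^ Suc k * q ^ (j ^ 2) * (qpoch (- (q ^ 2)) (q ^ 2) j * (1 + q ^ Suc k) / qpoch q q k)"
          by simp
        then show ?thesis
          by (simp only: mult_ac times_divide_eq_right)
      qed
      also have "\<dots> = q ^ Suc k * (1 + q ^ Suc k) * fps_nth weighted_odd_fps k"
        using less[of k] 3 k by simp
      also have "\<dots> = (q - q ^ n) * (1 - q ^ n) * fps_nth weighted_odd_fps n"
        using rec 3 by simp
      finally have "r = fps_nth weighted_odd_fps n"
        using nz by simp
      then show ?thesis
        using 3 k by (simp add: r_def)
    qed
  qed
qed

text \<open>Put Y(x) = (-x;q)_inf O(x) = U(x)/(x;q)_inf, where U is the weighted odd part. Computing
  Y(x) - Y(xq) from each form gives x times one side of the claim; then x is cancelled.\<close>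

lemma qexp_convolution_fps:
  assumes "q \<noteq> 0"
  shows "qexp_fps q 1 * (even_fps q + odd_fps q) = qgeom_fps q * Abs_fps (lowered_coeff q)"
proof -
  let ?D = "fps_dilate q" and ?U = weighted_odd_fps and ?E1 = "qgeom_fps q"
  define Y where "Y = (1 + fps_X) * qexp_fps q 1 * odd_fps q"
  have Y: "?E1 * ?U = Y"
  proof -
    have "?E1 * ?U = (?E1 * ((1 - fps_X) * qexp_fps q (- 1))) * Y"
      by (simp only: weighted_odd_fps_def Y_def mult.assoc)
    then show ?thesis
      unfolding qgeom_inverse by (simp only: mult_1)
  qed
  have "fps_nth (?U - (1 - fps_X) * ?D ?U) n = fps_nth (fps_X * Abs_fps (lowered_coeff q)) n" for n
  proof (cases n)
    case (Suc k)
    have 1: "(1 - q ^ n) * fps_nth ?U n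
        = (if odd n then q ^ ((n div 2) ^ 2) * qpoch (- (q ^ 2)) (q ^ 2) (n div 2) / qpoch q q k else 0)"
    proof -
      have "(1 - q ^ n) * (x / qpoch q q n) = x / qpoch q q k" for x
        unfolding Suc by (subst mult.commute) (rule div_qpoch_self_Suc)
      then show ?thesis
        unfolding weighted_odd_nth[OF assms]
        by (cases "odd n") (simp_all only: if_True if_False mult_zero_right simp_thms)
    qed
    \<comment> \<open>Since U is odd, exactly one summand survives: the first for even k, the second
      with its extra q^k for odd k. This is the parity split in
      \<open>lowered_coeff\<close>.\<close>
    have "fps_nth (?U - (1 - fps_X) * ?D ?U) n = (1 - q ^ n) * fps_nth ?U n + q ^ k * fps_nth ?U k"
      by (simp add: Suc algebra_simps)
    also have "\<dots> = lowered_coeff q k"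
      unfolding 1 unfolding weighted_odd_nth[OF assms] lowered_coeff_def
      using Suc by (auto simp: power_add)
    finally show ?thesis
      using Suc by simp
  qed (simp add: weighted_odd_nth[OF assms])
  then have W: "?U - (1 - fps_X) * ?D ?U = fps_X * Abs_fps (lowered_coeff q)"
    by (rule fps_ext)
  have "fps_X * (?E1 * Abs_fps (lowered_coeff q)) = ?E1 * ?U - ?D ?E1 * ?D ?U"
  proof -
    have "fps_X * (?E1 * Abs_fps (lowered_coeff q)) = ?E1 * (?U - (1 - fps_X) * ?D ?U)"
      unfolding W by (rule mult.left_commute)
    also have "\<dots> = ?E1 * ?U - ((1 - fps_X) * ?E1) * ?D ?U"
      by (subst right_diff_distrib) (simp only: mult_ac)
    finally show ?thesis
      unfolding dilate_qgeom .
  qed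
  also have "\<dots> = Y - ?D Y"
    by (simp add: Y flip: fps_dilate_mult)
  also have "\<dots> = qexp_fps q 1 * (odd_fps q - ?D (odd_fps q)) + fps_X * (qexp_fps q 1 * odd_fps q)"
    unfolding Y_def fps_dilate_mult[of q _ "odd_fps q"] dilate_qexp_plus
    by (simp only: ring_distribs mult_1 mult.assoc) simp
  also have "\<dots> = fps_X * (qexp_fps q 1 * (even_fps q + odd_fps q))"
    unfolding odd_fps_diff by (simp add: algebra_simps)
  finally have "fps_X * (?E1 * Abs_fps (lowered_coeff q))
      = fps_X * (qexp_fps q 1 * (even_fps q + odd_fps q))" .
  then show ?thesis
    unfolding mult_left_cancel[OF fps_X_neq_zero] by (rule sym)
qed

lemma qexp_convolution:
  assumes "q \<noteq> 0"
  shows "(\<Sum>m\<le>N. q ^ T m / qpoch q q m * (qpoch (- q) (q ^ 2) ((N - m) div 2) / qpoch q q (N - m)))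
       = (\<Sum>l\<le>N. lowered_coeff q l / qpoch q q (N - l))"
proof -
  have "fps_nth (even_fps q + odd_fps q) n = qpoch (- q) (q ^ 2) (n div 2) / qpoch q q n" for n
    by (simp add: even_fps_def odd_fps_def)
  then have "fps_nth (qexp_fps q 1 * (even_fps q + odd_fps q)) N =
      (\<Sum>m\<le>N. q ^ T m / qpoch q q m * (qpoch (- q) (q ^ 2) ((N - m) div 2) / qpoch q q (N - m)))"
    by (simp add: fps_mult_nth qexp_fps_def atMost_atLeast0 del: fps_add_nth)
  moreover have "fps_nth (Abs_fps (lowered_coeff q) * qgeom_fps q) N =
      (\<Sum>l\<le>N. lowered_coeff q l / qpoch q q (N - l))"
    by (simp add: fps_mult_nth qgeom_fps_def atMost_atLeast0)
  ultimately show ?thesis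
    using qexp_convolution_fps[OF assms] by (simp add: mult.commute)
qed

end

section \<open>Theorems of Euler and Cauchy\<close>

lemma qpoch_convergent:
  fixes q :: complex
  assumes "norm q < 1"
  shows "convergent_prod (\<lambda>j. 1 - a * q ^ j)"
proof -
  have "summable (\<lambda>j. norm a * norm q ^ j)"
    using assms by (intro summable_mult summable_geometric) simp
  then have "summable (\<lambda>j. norm (1 - a * q ^ j - 1))"
    by (simp add: norm_mult norm_power)
  then show ?thesis
    by (intro abs_convergent_prod_imp_convergent_prod summable_imp_abs_convergent_prod)
qed

lemma qpoch_tendsto:
  assumes "norm q < 1"
  shows "(\<lambda>n. qpoch a q n) \<longlonglongrightarrow> qpoch_inf a q"
proof -
  have "(\<lambda>n. qpoch a q (Suc n)) \<longlonglongrightarrow> qpoch_inf a q"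
    using convergent_prod_LIMSEQ[OF qpoch_convergent[OF assms, of a]]
    by (simp add: qpoch_def qpoch_inf_def lessThan_Suc_atMost)
  then show ?thesis
    by (rule LIMSEQ_imp_Suc)
qed

lemma qpoch_inf_self_nonzero:
  assumes "norm q < 1"
  shows "qpoch_inf q q \<noteq> 0"
  unfolding qpoch_inf_def
  using one_minus_power_nonzero[OF assms, of "Suc _"] assms
  by (intro prodinf_nonzero qpoch_convergent) auto

lemma qpoch_bound:
  assumes "norm q < 1"
  obtains C where "C > 0" "\<And>n. norm (qpoch a q n) \<le> C"
  using convergent_imp_Bseq[OF convergentI[OF qpoch_tendsto[OF assms, of a]]]
  by (auto simp: Bseq_def)

lemma inverse_qpoch_bound:
  assumes "norm q < 1"
  obtains C where "C > 0" "\<And>n. norm (inverse (qpoch q q n)) \<le> C"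
  using convergent_imp_Bseq[OF convergentI[OF tendsto_inverse[OF qpoch_tendsto[OF assms, of q]
        qpoch_inf_self_nonzero[OF assms]]]]
  by (auto simp: Bseq_def)

lemma qpoch_add: "qpoch a q (n + k) = qpoch a q n * qpoch (a * q ^ n) q k"
  by (induction k) (simp_all add: qpoch_Suc power_add mult_ac)

lemma qpoch_inf_split:
  assumes "norm q < 1"
  shows "qpoch_inf a q = qpoch a q n * qpoch_inf (a * q ^ n) q"
proof -
  have "(\<lambda>k. qpoch a q (k + n)) \<longlonglongrightarrow> qpoch_inf a q"
    by (rule LIMSEQ_ignore_initial_segment[OF qpoch_tendsto[OF assms]])
  moreover have "(\<lambda>k. qpoch a q (k + n)) \<longlonglongrightarrow> qpoch a q n * qpoch_inf (a * q ^ n) q"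
    unfolding add.commute[of _ n] qpoch_add by (intro tendsto_intros qpoch_tendsto assms)
  ultimately show ?thesis
    by (rule LIMSEQ_unique)
qed

lemma T_ge: "n \<le> T n"
  by (induction n) (auto simp: T_Suc)

lemma T_add: "T (m + n) = T m + T n + m * n"
  by (induction n) (auto simp: T_Suc)

lemma two_T: "T n + T n = n * n + n"
  by (induction n) (auto simp: T_Suc)

section \<open>Evaluation of two classical series\<close>

context
  fixes q :: complex
  assumes q: "norm q < 1"
begin

text \<open>The inverse q-Pochhammer symbols are bounded, and the remaining terms have ratio |x|
  |q|^(n+1), which tends to 0.\<close>

lemma euler_summable:
  "summable (\<lambda>n. norm (q ^ T n / qpoch q q n * x ^ n))"
proof -
  obtain C where C: "C > 0" "\<And>n. norm (inverse (qpoch q q n)) \<le> C"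
    using inverse_qpoch_bound[OF q] by blast
  have "summable (\<lambda>n. norm q ^ T n * norm x ^ n)"
  proof -
    have "(\<lambda>n. norm x * norm q ^ Suc n) \<longlonglongrightarrow> norm x * 0"
      using q by (intro tendsto_intros LIMSEQ_Suc LIMSEQ_power_zero) auto
    then have "\<forall>\<^sub>F n in sequentially. norm x * norm q ^ Suc n < 1/2"
      by (rule order_tendstoD) simp
    then obtain N where N: "\<And>n. n \<ge> N \<Longrightarrow> norm x * norm q ^ Suc n < 1/2"
      by (auto simp: eventually_at_top_linorder)
    show ?thesis
    proof (rule summable_ratio_test[of "1/2" N])
      fix n assume "n \<ge> N"
      then have "(norm x * norm q ^ Suc n) * (norm q ^ T n * norm x ^ n)
          \<le> (1/2) * (norm q ^ T n * norm x ^ n)"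
        using N[of n] by (intro mult_right_mono) auto
      then show "norm (norm q ^ T (Suc n) * norm x ^ Suc n) \<le> 1/2 * norm (norm q ^ T n * norm x ^ n)"
        by (simp add: T_Suc power_add mult_ac)
    qed simp
  qed
  then have "summable (\<lambda>n. C * (norm q ^ T n * norm x ^ n))"
    by (rule summable_mult)
  then show ?thesis
  proof (rule summable_comparison_test'[where N = 0])
    fix n
    have "norm (inverse (qpoch q q n)) * (norm q ^ T n * norm x ^ n) \<le> C * (norm q ^ T n * norm x ^ n)"
      using C by (intro mult_right_mono) auto
    then show "norm (norm (q ^ T n / qpoch q q n * x ^ n)) \<le> C * (norm q ^ T n * norm x ^ n)"
      by (simp add: norm_mult norm_divide norm_power norm_inverse field_simps)
  qed
qed

text \<open>The series satisfies e(x) = (1 + xq) e(xq). Iteration extracts the finite products, and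
  continuity at 0 with e(0) = 1 gives the limit.\<close>

theorem euler_has_sum:
  "((\<lambda>n. q ^ T n / qpoch q q n * x ^ n) has_sum qpoch_inf (- x * q) q) UNIV"
proof -
  define e where "e x = (\<Sum>n. q ^ T n / qpoch q q n * x ^ n)" for x
  have sm: "summable (\<lambda>n. q ^ T n / qpoch q q n * x ^ n)" for x
    using euler_summable by (rule summable_norm_cancel)
  have step: "e x = (1 + x * q) * e (x * q)" for x
  proof -
    have "e x - e (x * q) = (\<Sum>n. q ^ T n / qpoch q q n * x ^ n - q ^ T n / qpoch q q n * (x * q) ^ n)"
      unfolding e_def by (rule suminf_diff[OF sm sm])
    also have "\<dots> = (\<Sum>n. q ^ T (Suc n) / qpoch q q (Suc n) * x ^ Suc n
        - q ^ T (Suc n) / qpoch q q (Suc n) * (x * q) ^ Suc n)"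
      by (subst suminf_split_head[OF summable_diff[OF sm sm]]) simp
    also have "\<dots> = (\<Sum>n. x * q * (q ^ T n / qpoch q q n * (x * q) ^ n))"
    proof (rule suminf_cong)
      fix n
      have "q ^ T (Suc n) / qpoch q q (Suc n) * x ^ Suc n - q ^ T (Suc n) / qpoch q q (Suc n) * (x * q) ^ Suc n
          = q ^ T (Suc n) / qpoch q q (Suc n) * (1 - q ^ Suc n) * x ^ Suc n"
        unfolding power_mult_distrib by (simp only: ring_distribs mult_1 mult_1_right mult_ac)
      then show "q ^ T (Suc n) / qpoch q q (Suc n) * x ^ Suc n
          - q ^ T (Suc n) / qpoch q q (Suc n) * (x * q) ^ Suc n
          = x * q * (q ^ T n / qpoch q q n * (x * q) ^ n)"
        unfolding div_qpoch_self_Suc[OF q]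
        by (simp add: T_Suc power_add power_mult_distrib mult_ac)
    qed
    also have "\<dots> = x * q * e (x * q)"
      unfolding e_def by (rule suminf_mult[OF sm])
    finally show ?thesis
      by (simp add: algebra_simps)
  qed
  have iter: "e x = qpoch (- x * q) q n * e (x * q ^ n)" for n
    by (induction n) (simp_all add: qpoch_Suc step[of "x * q ^ _"] algebra_simps)
  have "isCont e 0"
    unfolding e_def using sm by (rule isCont_powser_converges_everywhere)
  moreover have "(\<lambda>n. x * q ^ n) \<longlonglongrightarrow> 0"
    using q by (intro tendsto_mult_right_zero LIMSEQ_power_zero)
  ultimately have "(\<lambda>n. e (x * q ^ n)) \<longlonglongrightarrow> e 0"
    by (rule isCont_tendsto_compose)
  also have "e 0 = 1"
    unfolding e_def by (subst powser_zero) (simp add: T_def)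
  finally have "(\<lambda>n. qpoch (- x * q) q n * e (x * q ^ n)) \<longlonglongrightarrow> qpoch_inf (- x * q) q * 1"
    by (intro tendsto_intros qpoch_tendsto q)
  then have "e x = qpoch_inf (- x * q) q"
    unfolding iter[symmetric] by (simp add: LIMSEQ_const_iff)
  then show ?thesis
    using norm_summable_imp_has_sum[OF euler_summable summable_sums[OF sm[of x]]]
    by (simp add: e_def)
qed

theorem cauchy_has_sum:
  "((\<lambda>s. q ^ (s * s + s * M) / (qpoch q q s * qpoch q q (s + M))) has_sum 1 / qpoch_inf q q) UNIV"
proof -
  define t where "t M s = q ^ (s * s + s * M) / (qpoch q q s * qpoch q q (s + M))" for M s
  \<comment> \<open>The sum \<open>f M\<close> does not depend on \<open>M\<close>, because the differences \<open>f M - f (M + 1)\<close> are bounded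
    and contract; its value is read off as \<open>M \<rightarrow> \<infinity>\<close>.\<close>
  define f where "f M = (\<Sum>s. t M s)" for M
  obtain C where C: "C > 0" "\<And>n. norm (inverse (qpoch q q n)) \<le> C"
    using inverse_qpoch_bound[OF q] by blast
  have bound: "norm (t M s) \<le> C * C * norm q ^ n" if "n \<le> s * s + s * M" for M s n
  proof -
    have "norm (t M s) = norm (inverse (qpoch q q s)) * norm (inverse (qpoch q q (s + M)))
        * norm q ^ (s * s + s * M)"
      by (simp add: t_def norm_mult norm_divide norm_power norm_inverse field_simps)
    also have "\<dots> \<le> C * C * norm q ^ n"
      using C q that by (intro mult_mono power_decreasing) (auto intro: less_imp_le)
    finally show ?thesis .
  qed
  have gs: "summable (\<lambda>s. c * norm q ^ s)" for c :: real
    using q by (intro summable_mult summable_geometric) simp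
  have nsm: "summable (\<lambda>s. norm (t M s))" for M
  proof (rule summable_comparison_test'[OF gs, where N = 0])
    fix s
    show "norm (norm (t M s)) \<le> C * C * norm q ^ s"
      using bound[of s s M] le_square[of s] by (simp add: trans_le_add1)
  qed
  then have sm: "summable (t M)" for M
    by (rule summable_norm_cancel)
  have rec: "f M - f (Suc M) = q ^ Suc M * (f (Suc (Suc M)) - f (Suc M))" for M
  proof -
    \<comment> \<open>\<open>g\<close> is \<open>t (M + 2)\<close> shifted by one place, with 0 in
      front: its sum is unchanged, and the identity for the sums now holds term by term.\<close>
    define g where "g s = (case s of 0 \<Rightarrow> 0 | Suc r \<Rightarrow> t (Suc (Suc M)) r)" for s
    have "(\<lambda>r. g (Suc r)) sums f (Suc (Suc M))"
      unfolding g_def f_def by (simp add: summable_sums sm)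
    then have g: "g sums f (Suc (Suc M))"
      by (subst (asm) sums_Suc_iff) (simp add: g_def)
    have "t M s - t (Suc M) s = q ^ Suc M * (g s - t (Suc M) s)" for s
    proof -
      \<comment> \<open>The common part: \<open>t M s\<close>, \<open>t (M + 1) s\<close> and
        \<open>q ^ (M + 1) * g s\<close> are \<open>u\<close> times 1 - q^(s+M+1), q^s and 1 -
        q^s.\<close>
      define u where "u = q ^ (s * s + s * M) / (qpoch q q s * qpoch q q (Suc (s + M)))"
      have "t M s = u * (1 - q ^ Suc (s + M))"
        unfolding t_def u_def divide_divide_eq_left[symmetric]
        by (rule div_qpoch_self_Suc[OF q, symmetric])
      moreover have "t (Suc M) s = u * q ^ s"
        by (simp add: t_def u_def power_add algebra_simps)
      moreover have "q ^ Suc M * g s = u * (1 - q ^ s)"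
      proof (cases s)
        case (Suc r)
        have "u * (1 - q ^ s) = q ^ (s * s + s * M) / qpoch q q (Suc (s + M)) / qpoch q q s * (1 - q ^ s)"
          by (simp add: u_def mult.commute)
        also have "\<dots> = q ^ (s * s + s * M) / qpoch q q (Suc (s + M)) / qpoch q q r"
          unfolding Suc by (rule div_qpoch_self_Suc[OF q])
        also have "s * s + s * M = Suc M + (r * r + r * Suc (Suc M))"
          by (simp add: Suc)
        finally show ?thesis
          unfolding power_add[of q "Suc M"]
          by (simp add: g_def t_def Suc mult_ac del: power_Suc mult_Suc mult_Suc_right)
      qed (simp add: g_def)
      ultimately show ?thesis
        by (simp add: power_add algebra_simps)
    qed
    then have "(\<lambda>s. t M s - t (Suc M) s) sums (q ^ Suc M * (f (Suc (Suc M)) - f (Suc M)))"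
      unfolding f_def[of "Suc M"] by (simp only:) (intro sums_mult sums_diff g summable_sums sm)
    moreover have "(\<lambda>s. t M s - t (Suc M) s) sums (f M - f (Suc M))"
      unfolding f_def by (intro sums_diff summable_sums sm)
    ultimately show ?thesis
      by (rule sums_unique2[symmetric])
  qed
  define K where "K = (\<Sum>s. C * C * norm q ^ s)"
  have fK: "norm (f M) \<le> K" for M
    unfolding f_def K_def using bound by (intro norm_suminf_le gs) (simp add: le_square trans_le_add1)
  have diff: "norm (f M - f (Suc M)) \<le> norm q ^ n * (2 * K)" for M n
  proof (induction n arbitrary: M)
    case 0
    show ?case
      using norm_triangle_ineq4[of "f M" "f (Suc M)"] fK[of M] fK[of "Suc M"] by simp
  next
    case (Suc n)
    have "norm (f M - f (Suc M)) = norm q ^ Suc M * norm (f (Suc M) - f (Suc (Suc M)))"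
      unfolding rec[of M] by (simp add: norm_mult norm_power norm_minus_commute)
    also have "\<dots> \<le> norm q * (norm q ^ n * (2 * K))"
      using q by (intro mult_mono Suc power_Suc_le_self) auto
    finally show ?case
      by simp
  qed
  have const: "f M = f (Suc M)" for M
  proof -
    have "(\<lambda>n. norm q ^ n * (2 * K)) \<longlonglongrightarrow> 0"
      using q by (intro tendsto_mult_left_zero LIMSEQ_power_zero) simp
    then have "norm (f M - f (Suc M)) \<le> 0"
      using diff by (intro LIMSEQ_le_const) auto
    then show ?thesis
      by simp
  qed
  have f0: "f M = f 0" for M
    by (induction M) (simp_all add: const[symmetric])
  \<comment> \<open>The term s = 0 is 1/(q)_M; every later exponent contains at least one M, so the
    rest is O(|q|^M).\<close>
  have "norm (f M - 1 / qpoch q q M) \<le> norm q ^ M * K" for M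
  proof -
    have "f M - 1 / qpoch q q M = (\<Sum>s. t M (Suc s))"
      unfolding f_def by (subst suminf_split_head[OF sm]) (simp add: t_def)
    also have "norm \<dots> \<le> (\<Sum>s. norm q ^ M * (C * C * norm q ^ s))"
    proof (intro norm_suminf_le summable_mult[OF gs])
      fix s
      have "norm (t M (Suc s)) \<le> C * C * norm q ^ (M + s)"
        by (rule bound) simp
      then show "norm (t M (Suc s)) \<le> norm q ^ M * (C * C * norm q ^ s)"
        by (simp add: power_add mult_ac)
    qed
    also have "\<dots> = norm q ^ M * K"
      unfolding K_def by (rule suminf_mult[OF gs])
    finally show ?thesis .
  qed
  moreover have "(\<lambda>M. norm q ^ M * K) \<longlonglongrightarrow> 0"
    using q by (intro tendsto_mult_left_zero LIMSEQ_power_zero) simp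
  ultimately have "(\<lambda>M. f M - 1 / qpoch q q M) \<longlonglongrightarrow> 0"
    by (rule Lim_null_comparison[OF always_eventually[OF allI]])
  moreover have "(\<lambda>M. 1 / qpoch q q M) \<longlonglongrightarrow> 1 / qpoch_inf q q"
    by (intro tendsto_intros qpoch_tendsto q qpoch_inf_self_nonzero)
  ultimately have "(\<lambda>M. (f M - 1 / qpoch q q M) + 1 / qpoch q q M) \<longlonglongrightarrow> 0 + 1 / qpoch_inf q q"
    by (rule tendsto_add)
  then have "f \<longlonglongrightarrow> 1 / qpoch_inf q q"
    by simp
  moreover have "f \<longlonglongrightarrow> f 0"
  proof -
    have "f = (\<lambda>_. f 0)"
      using f0 by (rule ext)
    then show ?thesis
      by (metis tendsto_const)
  qed
  ultimately have "f 0 = 1 / qpoch_inf q q"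
    using LIMSEQ_unique by blast
  then have "f M = 1 / qpoch_inf q q"
    using f0[of M] by simp
  moreover have "(t M has_sum f M) UNIV"
    unfolding f_def by (rule norm_summable_imp_has_sum[OF nsm summable_sums[OF sm]])
  moreover have "t M = (\<lambda>s. q ^ (s * s + s * M) / (qpoch q q s * qpoch q q (s + M)))"
    by (rule ext) (simp only: t_def)
  ultimately show ?thesis
    by simp
qed

end

section \<open>A Bailey pair supported on even indices\<close>

lemma summable_on_nonneg_times:
  fixes f :: "'a \<Rightarrow> real" and g :: "'b \<Rightarrow> real"
  assumes "f summable_on A" "g summable_on B" "\<And>x. f x \<ge> 0" "\<And>y. g y \<ge> 0"
  shows "(\<lambda>(x, y). f x * g y) summable_on A \<times> B"
proof (rule summable_on_SigmaI)
  show "((\<lambda>y. case (x, y) of (x, y) \<Rightarrow> f x * g y) has_sum f x * infsum g B) B" for x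
    using has_sum_cmult_right[OF has_sum_infsum[OF assms(2)]] by simp
  show "(\<lambda>x. f x * infsum g B) summable_on A"
    by (rule summable_on_cmult_left[OF assms(1)])
qed (use assms in auto)

lemma summable_on_power_nat:
  fixes r :: real
  assumes "0 \<le> r" "r < 1"
  shows "(\<lambda>n. r ^ n) summable_on UNIV"
  using assms by (intro norm_summable_imp_summable_on) (simp add: summable_geometric norm_power)

lemma bij_betw_int_nonneg: "bij_betw int UNIV {0..}"
  by (rule bij_betw_byWitness[where f' = nat]) auto

lemma bij_betw_int_neg: "bij_betw (\<lambda>n. - int (Suc n)) UNIV {..<0}"
  by (rule bij_betw_byWitness[where f' = "\<lambda>i. nat (- i - 1)"]) auto

lemma summable_on_power_abs_int:
  fixes r :: real
  assumes "0 \<le> r" "r < 1"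
  shows "(\<lambda>i::int. r ^ nat \<bar>i\<bar>) summable_on UNIV"
proof -
  have "(\<lambda>i::int. r ^ nat \<bar>i\<bar>) summable_on {0..}"
    using summable_on_reindex_bij_betw[OF bij_betw_int_nonneg, of "\<lambda>i. r ^ nat \<bar>i\<bar>"]
      summable_on_power_nat[OF assms] by simp
  moreover have "(\<lambda>i::int. r ^ nat \<bar>i\<bar>) summable_on {..<0}"
    using summable_on_reindex_bij_betw[OF bij_betw_int_neg, of "\<lambda>i. r ^ nat \<bar>i\<bar>"]
      summable_on_cmult_right[OF summable_on_power_nat[OF assms], of r]
    by (simp add: nat_add_distrib add.commute)
  ultimately have "(\<lambda>i::int. r ^ nat \<bar>i\<bar>) summable_on {0..} \<union> {..<0}"
    by (rule summable_on_Un_disjoint) auto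
  moreover have "{0..} \<union> {..<0} = (UNIV :: int set)"
    by auto
  ultimately show ?thesis
    by simp
qed

text \<open>Setting \<open>1/(q)\<^sub>a = 0\<close> for \<open>a < 0\<close> makes \<open>(1 - q\<^sup>a)/(q)\<^sub>a = 1/(q)\<^bsub>a-1\<^esub>\<close> hold for all integers.\<close>

definition inv_qpoch :: "complex \<Rightarrow> int \<Rightarrow> complex" where
  "inv_qpoch q a = (if a < 0 then 0 else inverse (qpoch q q (nat a)))"

text \<open>
  Up to the factor \<open>(q)\<^sub>M\<close>, \<open>even_sum q c M k\<close> is an alternating sum of the q-binomial coefficients
  with upper index \<open>M\<close> and lower index \<open>k - 2i\<close>, weighted by \<open>q\<^bsup>i(i+c)\<^esup>\<close>.
\<close>

definition even_term :: "complex \<Rightarrow> int \<Rightarrow> int \<Rightarrow> int \<Rightarrow> int \<Rightarrow> complex" where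
  "even_term q c M k i = (- 1) powi i * q powi (i * i + c * i) *
     inv_qpoch q (k - 2 * i) * inv_qpoch q (M - k + 2 * i)"

definition even_sum :: "complex \<Rightarrow> int \<Rightarrow> int \<Rightarrow> int \<Rightarrow> complex" where
  "even_sum q c M k = infsum (even_term q c M k) UNIV"

lemma even_term_zero: "2 * i < k - M \<or> 2 * i > k \<Longrightarrow> even_term q c M k i = 0"
  by (auto simp: even_term_def inv_qpoch_def)

lemma even_term_summable: "even_term q c M k summable_on UNIV"
proof (rule finite_nonzero_values_imp_summable_on)
  have "{i \<in> UNIV. even_term q c M k i \<noteq> 0} \<subseteq> {- \<bar>k\<bar> - \<bar>M\<bar>..\<bar>k\<bar>}"
  proof
    fix i assume "i \<in> {i \<in> UNIV. even_term q c M k i \<noteq> 0}"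
    then have "\<not> (2 * i < k - M \<or> 2 * i > k)"
      using even_term_zero by blast
    then show "i \<in> {- \<bar>k\<bar> - \<bar>M\<bar>..\<bar>k\<bar>}"
      unfolding atLeastAtMost_iff by arith
  qed
  then show "finite {i \<in> UNIV. even_term q c M k i \<noteq> 0}"
    by (rule finite_subset) simp
qed

lemma bij_uminus_int: "bij (\<lambda>i::int. c - i)"
  by (rule bij_betw_byWitness[where f' = "\<lambda>i. c - i"]) auto

text \<open>The substitution i -> -i exchanges the two inverse q-Pochhammer factors and changes the
  sign of c.\<close>

lemma even_sum_reflect: "even_sum q c M k = even_sum q (- c) M (M - k)"
proof -
  have "even_sum q c M k = infsum (\<lambda>i. even_term q c M k (0 - i)) UNIV"
    unfolding even_sum_def by (rule infsum_reindex_bij_betw[OF bij_uminus_int, symmetric])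
  also have "(\<lambda>i. even_term q c M k (0 - i)) = even_term q (- c) M (M - k)"
    by (rule ext) (simp add: even_term_def power_int_minus_one_minus mult_ac)
  finally show ?thesis
    by (simp add: even_sum_def)
qed

text \<open>For M = 2k + 2 the substitution i -> -1 - i exchanges the two inverse factors and
  preserves i(i + 1), but flips (-1)^i; the sum is its own negative.\<close>

lemma even_sum_vanishing:
  assumes "M = 2 * k + 2"
  shows "even_sum q 1 M k = 0"
proof -
  have "even_sum q 1 M k = infsum (\<lambda>i. even_term q 1 M k (- 1 - i)) UNIV"
    unfolding even_sum_def by (rule infsum_reindex_bij_betw[OF bij_uminus_int, symmetric])
  also have "(\<lambda>i. even_term q 1 M k (- 1 - i)) = (\<lambda>i. - even_term q 1 M k i)"
  proof
    fix i
    have "(- 1 :: complex) powi (- 1 - i) = - ((- 1) powi i)"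
      using power_int_minus_one_minus[of "1 + i", where ?'a = complex]
      by (simp add: power_int_add algebra_simps)
    moreover have "(- 1 - i) * (- 1 - i) + 1 * (- 1 - i) = i * i + 1 * i"
      by (simp add: algebra_simps)
    moreover have "k - 2 * (- 1 - i) = M - k + 2 * i" "M - k + 2 * (- 1 - i) = k - 2 * i"
      using assms by simp_all
    ultimately have "even_term q 1 M k (- 1 - i) = - ((- 1) powi i) * q powi (i * i + 1 * i) *
        inv_qpoch q (M - k + 2 * i) * inv_qpoch q (k - 2 * i)"
      unfolding even_term_def by (simp only:)
    then show "even_term q 1 M k (- 1 - i) = - even_term q 1 M k i"
      by (simp add: even_term_def)
  qed
  also have "infsum (\<lambda>i. - even_term q 1 M k i) UNIV = - even_sum q 1 M k"
    unfolding even_sum_def by (rule infsum_uminus)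
  finally show ?thesis
    by simp
qed

section \<open>q-Pascal rules and the closed form\<close>

context
  fixes q :: complex
  assumes q: "norm q < 1" and q0: "q \<noteq> 0"
begin

lemma inv_qpoch_pred: "(1 - q powi a) * inv_qpoch q a = inv_qpoch q (a - 1)"
proof -
  consider "a < 0" | "a = 0" | "a > 0"
    by linarith
  then show ?thesis
  proof cases
    case 3
    define n where "n = nat (a - 1)"
    have "a = int (Suc n)"
      using 3 by (simp add: n_def)
    then have [simp]: "q powi a = q ^ Suc n"
      by (simp only: power_int_of_nat)
    have [simp]: "nat a = Suc n" "nat (a - 1) = n"
      using 3 by (simp_all add: n_def)
    show ?thesis
      using one_minus_power_nonzero[OF q, of "Suc n"] 3
      by (simp add: inv_qpoch_def qpoch_self_Suc del: power_Suc)
  qed (simp_all add: inv_qpoch_def)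
qed

text \<open>The q-Pascal rule: with A = k - 2i and B = M - A, 1 - q^(A+B) = (1 - q^A) + q^A (1 -
  q^B), and each bracket lowers one index. The factor q^A = q^k q^(-2i) accounts for the shift of c
  by -2.\<close>

lemma even_term_pascal1:
  "(1 - q powi M) * even_term q c M k i
     = even_term q c (M - 1) (k - 1) i + q powi k * even_term q (c - 2) (M - 1) k i"
proof -
  define A B where "A = k - 2 * i" and "B = M - k + 2 * i"
  define e where "e = (- 1) powi i * q powi (i * i + c * i)"
  have split: "1 - q powi M = (1 - q powi A) + q powi A * (1 - q powi B)"
  proof -
    have "M = A + B"
      by (simp add: A_def B_def)
    then have "q powi M = q powi A * q powi B"
      using q0 by (simp add: power_int_add)
    then show ?thesis
      by (simp add: right_diff_distrib)
  qed
  have "(1 - q powi M) * even_term q c M k i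
      = e * (((1 - q powi A) * inv_qpoch q A) * inv_qpoch q B)
        + q powi A * e * (inv_qpoch q A * ((1 - q powi B) * inv_qpoch q B))"
  proof -
    have "even_term q c M k i = e * inv_qpoch q A * inv_qpoch q B"
      by (simp add: even_term_def e_def A_def B_def)
    then show ?thesis
      unfolding split by (simp only: distrib_left distrib_right mult_ac)
  qed
  also have "\<dots> = e * (inv_qpoch q (A - 1) * inv_qpoch q B)
        + q powi A * e * (inv_qpoch q A * inv_qpoch q (B - 1))"
    by (simp only: inv_qpoch_pred)
  also have "e * (inv_qpoch q (A - 1) * inv_qpoch q B) = even_term q c (M - 1) (k - 1) i"
    by (simp add: even_term_def e_def A_def B_def algebra_simps)
  also have "q powi A * e = q powi k * ((- 1) powi i * q powi (i * i + (c - 2) * i))"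
  proof -
    have "q powi A * q powi (i * i + c * i) = q powi k * q powi (i * i + (c - 2) * i)"
    proof -
      have "A + (i * i + c * i) = k + (i * i + (c - 2) * i)"
        by (simp add: A_def left_diff_distrib)
      then show ?thesis
        using q0 by (metis power_int_add)
    qed
    then show ?thesis
      unfolding e_def by (simp add: mult_ac)
  qed
  finally show ?thesis
    by (simp add: even_term_def A_def B_def algebra_simps)
qed

lemma even_sum_pascal1:
  "(1 - q powi M) * even_sum q c M k
     = even_sum q c (M - 1) (k - 1) + q powi k * even_sum q (c - 2) (M - 1) k"
proof -
  have "(1 - q powi M) * even_sum q c M k = infsum (\<lambda>i. (1 - q powi M) * even_term q c M k i) UNIV"
    unfolding even_sum_def by (rule infsum_cmult_right'[symmetric])
  also have "\<dots> = even_sum q c (M - 1) (k - 1) + infsum (\<lambda>i. q powi k * even_term q (c - 2) (M - 1) k i) UNIV"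
    unfolding even_term_pascal1 even_sum_def
    by (intro infsum_add even_term_summable summable_on_cmult_right)
  also have "infsum (\<lambda>i. q powi k * even_term q (c - 2) (M - 1) k i) UNIV
      = q powi k * even_sum q (c - 2) (M - 1) k"
    unfolding even_sum_def by (rule infsum_cmult_right')
  finally show ?thesis .
qed

lemma even_sum_pascal2:
  "(1 - q powi M) * even_sum q c M k
     = even_sum q c (M - 1) k + q powi (M - k) * even_sum q (c + 2) (M - 1) (k - 1)"
proof -
  have "even_sum q c (M - 1) k = even_sum q (- c) (M - 1) (M - k - 1)"
  proof -
    have "M - 1 - k = M - k - 1"
      by simp
    then show ?thesis
      using even_sum_reflect[of q c "M - 1" k] by (simp only:)
  qed
  moreover have "even_sum q (c + 2) (M - 1) (k - 1) = even_sum q (- c - 2) (M - 1) (M - k)"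
  proof -
    have "- (c + 2) = - c - 2" "M - 1 - (k - 1) = M - k"
      by simp_all
    then show ?thesis
      using even_sum_reflect[of q "c + 2" "M - 1" "k - 1"] by (simp only:)
  qed
  ultimately show ?thesis
    using even_sum_pascal1[of M "- c" "M - k"] even_sum_reflect[of q c M k] by metis
qed

text \<open>The second q-Pascal rule leaves an extra sum with c = 1, upper index 2n and lower index
  n - 1, which vanishes by symmetry.\<close>

lemma even_sum_odd_eq:
  "(1 - q ^ (2 * n + 1)) * even_sum q (- 1) (2 * int n + 1) (int n) = even_sum q (- 1) (2 * int n) (int n)"
proof -
  have "q powi (2 * int n + 1) = q ^ (2 * n + 1)"
  proof -
    have "2 * int n + 1 = int (2 * n + 1)"
      by simp
    then show ?thesis
      by (simp only: power_int_of_nat)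
  qed
  then show ?thesis
    using even_sum_pascal2[of "2 * int n + 1" "- 1" "int n"] even_sum_vanishing[of "2 * int n" "int n - 1" q]
    by simp
qed

text \<open>Two q-Pascal steps lead from 2n + 2 to 2n. In the first, reflection identifies both
  resulting sums with \<open>e\<close>, hence the factor 1 + q^(n+1); in the second, one of the two
  sums vanishes by symmetry.\<close>

lemma even_sum_recurrence:
  "(1 - q ^ (2 * n + 2)) * (1 - q ^ (2 * n + 1)) * even_sum q (- 1) (2 * int (Suc n)) (int (Suc n))
     = (1 + q ^ Suc n) * q ^ n * even_sum q (- 1) (2 * int n) (int n)"
proof -
  define e where "e = even_sum q (- 1) (2 * int n + 1) (int n + 1)"
  have p1: "q powi (2 * int n + 2) = q ^ (2 * n + 2)" "q powi (2 * int n + 1) = q ^ (2 * n + 1)"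
    "q powi (int n + 1) = q ^ Suc n"
  proof -
    have "2 * int n + 2 = int (2 * n + 2)" "2 * int n + 1 = int (2 * n + 1)" "int n + 1 = int (Suc n)"
      by simp_all
    then show "q powi (2 * int n + 2) = q ^ (2 * n + 2)" "q powi (2 * int n + 1) = q ^ (2 * n + 1)"
      "q powi (int n + 1) = q ^ Suc n"
      by (simp_all only: power_int_of_nat)
  qed
  have 1: "(1 - q ^ (2 * n + 2)) * even_sum q (- 1) (2 * int (Suc n)) (int (Suc n)) = (1 + q ^ Suc n) * e"
  proof -
    have "even_sum q (- 1) (2 * int n + 2) (int n + 1) = even_sum q 1 (2 * int n + 2) (int n + 1)"
      using even_sum_reflect[of q 1 "2 * int n + 2" "int n + 1"] by simp
    moreover have "(1 - q powi (2 * int n + 2)) * even_sum q 1 (2 * int n + 2) (int n + 1)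
        = even_sum q 1 (2 * int n + 1) (int n) + q powi (int n + 1) * e"
      using even_sum_pascal1[of "2 * int n + 2" 1 "int n + 1"] by (simp add: e_def algebra_simps)
    moreover have "even_sum q 1 (2 * int n + 1) (int n) = e"
      using even_sum_reflect[of q 1 "2 * int n + 1" "int n"] by (simp add: e_def)
    ultimately show ?thesis
      unfolding p1 by (simp add: algebra_simps)
  qed
  have "even_sum q (- 1) (2 * int n) (int n + 1) = 0"
    using even_sum_reflect[of q 1 "2 * int n" "int n - 1"] even_sum_vanishing[of "2 * int n" "int n - 1" q]
    by simp
  moreover have "even_sum q 1 (2 * int n) (int n) = even_sum q (- 1) (2 * int n) (int n)"
    using even_sum_reflect[of q 1 "2 * int n" "int n"] by simp
  ultimately have 2: "(1 - q ^ (2 * n + 1)) * e = q ^ n * even_sum q (- 1) (2 * int n) (int n)"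
    using even_sum_pascal2[of "2 * int n + 1" "- 1" "int n + 1"] unfolding p1 e_def by simp
  have "(1 - q ^ (2 * n + 2)) * (1 - q ^ (2 * n + 1)) * even_sum q (- 1) (2 * int (Suc n)) (int (Suc n))
      = (1 - q ^ (2 * n + 1)) * ((1 - q ^ (2 * n + 2)) * even_sum q (- 1) (2 * int (Suc n)) (int (Suc n)))"
    by (simp only: mult_ac)
  also have "\<dots> = (1 + q ^ Suc n) * ((1 - q ^ (2 * n + 1)) * e)"
    unfolding 1 by (simp only: mult_ac)
  finally show ?thesis
    unfolding 2 by (simp only: mult_ac)
qed

lemma even_sum_0: "even_sum q c 0 0 = 1"
proof -
  have "(even_term q c 0 0 has_sum (\<Sum>i\<in>{0}. even_term q c 0 0 i)) UNIV"
  proof (rule has_sum_finite_neutralI)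
    show "even_term q c 0 0 i = 0" if "i \<in> UNIV - {0}" for i
      using that by (intro even_term_zero) auto
  qed auto
  then show ?thesis
    by (simp add: even_sum_def even_term_def inv_qpoch_def infsumI)
qed

text \<open>After multiplication by (q)_{2n} the recurrence for upper index 2n becomes a plain
  product; \<open>even_sum_odd_eq\<close> then passes to 2n + 1. This is the closed form of the beta
  side of the Bailey pair, up to normalization.\<close>

theorem even_sum_eq:
  "q ^ n * even_sum q (- 1) (2 * int n + 1) (int n) = q ^ T n * qpoch (- q) q n / qpoch q q (2 * n + 1)"
proof -
  have *: "q ^ n * even_sum q (- 1) (2 * int n) (int n) * qpoch q q (2 * n) = q ^ T n * qpoch (- q) q n"
  proof (induction n)
    case 0
    show ?case by (simp add: even_sum_0)
  next
    case (Suc n)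
    have "qpoch q q (2 * Suc n) = qpoch q q (2 * n) * ((1 - q ^ (2 * n + 2)) * (1 - q ^ (2 * n + 1)))"
      by (simp add: qpoch_self_Suc mult_ac)
    then have "q ^ Suc n * even_sum q (- 1) (2 * int (Suc n)) (int (Suc n)) * qpoch q q (2 * Suc n)
       = q ^ Suc n * qpoch q q (2 * n) * ((1 - q ^ (2 * n + 2)) * (1 - q ^ (2 * n + 1))
            * even_sum q (- 1) (2 * int (Suc n)) (int (Suc n)))"
      by (simp only: mult_ac)
    also have "\<dots> = q ^ Suc n * (1 + q ^ Suc n)
        * (q ^ n * even_sum q (- 1) (2 * int n) (int n) * qpoch q q (2 * n))"
      unfolding even_sum_recurrence by (simp only: mult_ac)
    also have "\<dots> = q ^ Suc n * (1 + q ^ Suc n) * (q ^ T n * qpoch (- q) q n)"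
      by (simp only: Suc)
    also have "\<dots> = q ^ T (Suc n) * qpoch (- q) q (Suc n)"
      by (simp add: T_Suc qpoch_Suc power_add mult_ac)
    finally show ?case .
  qed
  have nz: "qpoch q q (2 * n + 1) \<noteq> 0" "1 - q ^ (2 * n + 1) \<noteq> 0" "qpoch q q (2 * n) \<noteq> 0"
    by (simp_all only: qpoch_self_nonzero[OF q] one_minus_power_nonzero[OF q]) simp_all
  have "q ^ n * even_sum q (- 1) (2 * int n + 1) (int n) * qpoch q q (2 * n + 1)
      = q ^ n * ((1 - q ^ (2 * n + 1)) * even_sum q (- 1) (2 * int n + 1) (int n)) * qpoch q q (2 * n)"
    by (simp add: qpoch_self_Suc mult_ac)
  also have "\<dots> = q ^ T n * qpoch (- q) q n"
    unfolding even_sum_odd_eq by (rule *)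
  finally show ?thesis
    using nz by (simp add: field_simps)
qed

end

section \<open>The Jacobi triple product and the Bailey sum\<close>

lemma has_sum_times:
  fixes f :: "'a \<Rightarrow> complex" and g :: "'b \<Rightarrow> complex"
  assumes "(f has_sum a) A" "(g has_sum b) B"
    and "(\<lambda>(x, y). f x * g y) summable_on A \<times> B"
  shows "((\<lambda>(x, y). f x * g y) has_sum a * b) (A \<times> B)"
proof (rule has_sum_SigmaI)
  show "((\<lambda>y. case (x, y) of (x, y) \<Rightarrow> f x * g y) has_sum f x * b) B" for x
    using has_sum_cmult_right[OF assms(2)] by simp
  show "((\<lambda>x. f x * b) has_sum a * b) A"
    by (rule has_sum_cmult_left[OF assms(1)])
qed (rule assms)

lemma has_sum_antidiagonal:
  fixes f :: "nat \<times> nat \<Rightarrow> complex"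
  assumes "(f has_sum S) UNIV"
  shows "((\<lambda>N. \<Sum>m\<le>N. f (m, N - m)) has_sum S) UNIV"
proof -
  have "bij_betw (\<lambda>(N, m). (m, N - m)) (SIGMA N:UNIV. {..N}) (UNIV :: (nat \<times> nat) set)"
    by (rule bij_betw_byWitness[where f' = "\<lambda>(m, k). (m + k, m)"]) auto
  from has_sum_reindex_bij_betw[OF this, of f S]
  have "((\<lambda>(N, m). f (m, N - m)) has_sum S) (SIGMA N:UNIV. {..N})"
    using assms by (simp add: case_prod_unfold)
  then show ?thesis
    by (rule has_sum_SigmaD) (simp add: has_sum_finite)
qed

lemma has_sum_pairs:
  fixes h :: "nat \<Rightarrow> complex"
  assumes "(h has_sum S) UNIV"
  shows "((\<lambda>n. h (2 * n) + h (2 * n + 1)) has_sum S) UNIV"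
proof -
  have "bij_betw (\<lambda>(n, b). 2 * n + b) (UNIV \<times> {0, 1}) (UNIV :: nat set)"
    by (rule bij_betw_byWitness[where f' = "\<lambda>m. (m div 2, m mod 2)"]) auto
  from has_sum_reindex_bij_betw[OF this, of h S]
  have "((\<lambda>(n, b). h (2 * n + b)) has_sum S) (UNIV \<times> {0, 1})"
    using assms by (simp add: case_prod_unfold)
  then show ?thesis
  proof (rule has_sum_SigmaD)
    fix n :: nat
    show "((\<lambda>b. case (n, b) of (n, b) \<Rightarrow> h (2 * n + b)) has_sum h (2 * n) + h (2 * n + 1)) {0, 1}"
      using has_sum_finite[of "{0, 1 :: nat}" "\<lambda>b. h (2 * n + b)"] by simp
  qed
qed

text \<open>A pair of naturals is determined by its difference j and its minimum s; truncation by
  \<open>nat\<close> makes one of \<open>nat j\<close> and \<open>nat (- j)\<close> zero.\<close>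

lemma bij_int_nat_pairs:
  "bij_betw (\<lambda>(j, s). (s + nat j, s + nat (- j))) (UNIV \<times> UNIV) (UNIV :: (nat \<times> nat) set)"
  by (rule bij_betw_byWitness[where f' = "\<lambda>(a, b). (int a - int b, min a b)"]) auto

context
  fixes q :: complex
  assumes q: "norm q < 1" and q0: "q \<noteq> 0"
begin

text \<open>Multiply Euler's series at x and at y = 1/(xq) and group the terms by the difference j
  of the exponents. For fixed j the inner sum is Cauchy's with M = |j|, so every j yields the same
  factor 1/(q)_inf.\<close>

theorem jacobi_triple_product:
  assumes x: "x \<noteq> 0"
  shows "((\<lambda>j. x powi j * q powi ((j * j + j) div 2)) has_sum
    qpoch_inf q q * qpoch_inf (- x * q) q * qpoch_inf (- 1 / x) q) UNIV"
proof -
  define y where "y = 1 / (x * q)"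
  define E where "E z n = q ^ T n / qpoch q q n * z ^ n" for z n
  define e where "e j = (j * j + j) div 2" for j :: int
  have "(\<lambda>(a, b). norm (E x a) * norm (E y b)) summable_on UNIV \<times> UNIV"
    using norm_summable_imp_summable_on[of "\<lambda>n. norm (E _ n)"] euler_summable[OF q]
    by (intro summable_on_nonneg_times) (simp_all add: E_def)
  then have "(\<lambda>p. norm (case p of (a, b) \<Rightarrow> E x a * E y b)) summable_on UNIV \<times> UNIV"
    by (simp add: case_prod_unfold norm_mult)
  then have sm: "(\<lambda>(a, b). E x a * E y b) summable_on UNIV \<times> UNIV"
    by (rule abs_summable_summable)
  have "((\<lambda>(a, b). E x a * E y b) has_sum qpoch_inf (- x * q) q * qpoch_inf (- y * q) q) (UNIV \<times> UNIV)"
    by (rule has_sum_times[OF _ _ sm]) (unfold E_def, (rule euler_has_sum[OF q])+)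
  moreover have "- y * q = - 1 / x"
    using q0 by (simp add: y_def)
  ultimately have "((\<lambda>(a, b). E x a * E y b) has_sum qpoch_inf (- x * q) q * qpoch_inf (- 1 / x) q) UNIV"
    by simp
  then have "((\<lambda>(j, s). E x (s + nat j) * E y (s + nat (- j))) has_sum
      qpoch_inf (- x * q) q * qpoch_inf (- 1 / x) q) (UNIV \<times> UNIV)"
    using has_sum_reindex_bij_betw[OF bij_int_nat_pairs, of "\<lambda>(a, b). E x a * E y b"]
    by (simp add: case_prod_unfold)
  then have "((\<lambda>j. x powi j * q powi e j * (1 / qpoch_inf q q)) has_sum
      qpoch_inf (- x * q) q * qpoch_inf (- 1 / x) q) UNIV"
  proof (rule has_sum_SigmaD)
    fix j :: int
    define M where "M = nat \<bar>j\<bar>"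
    have term_eq: "E x (s + nat j) * E y (s + nat (- j))
        = x powi j * q powi e j * (q ^ (s * s + s * M) / (qpoch q q s * qpoch q q (s + M)))" for s
    proof -
      \<comment> \<open>The isolated s supplies the q^s that combines with x^s y^s to (xqy)^s =
        1.\<close>
      have TT: "T (s + M) + T s = s + (s * s + s * M) + T M"
        using two_T[of s] by (simp add: T_add)
      have "2 * int (T M) = int (T M + T M)"
        by simp
      also have "\<dots> = int M * int M + int M"
        unfolding two_T by simp
      finally have e_pos: "e (int M) = int (T M)" and e_neg: "e (- int M) = int (T M) - int M"
        by (auto simp: e_def)
      show ?thesis
      proof (cases "j \<ge> 0")
        case True
        then have j: "j = int M" "nat j = M" "nat (- j) = 0"
          by (simp_all add: M_def)
        have "E x (s + M) * E y s
            = q ^ (T (s + M) + T s) * x ^ (s + M) * y ^ s / (qpoch q q s * qpoch q q (s + M))"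
          by (simp add: E_def power_add mult_ac)
        also have "\<dots> = (x * q * y) ^ s * (x ^ M * q ^ T M) *
            (q ^ (s * s + s * M) / (qpoch q q s * qpoch q q (s + M)))"
          unfolding TT by (simp add: power_add power_mult_distrib mult_ac)
        finally show ?thesis
          using x q0 by (simp add: j e_pos y_def)
      next
        case False
        then have j: "j = - int M" "nat j = 0" "nat (- j) = M"
          by (simp_all add: M_def)
        have "E x s * E y (s + M)
            = q ^ (T (s + M) + T s) * x ^ s * y ^ (s + M) / (qpoch q q s * qpoch q q (s + M))"
          by (simp add: E_def power_add mult_ac)
        also have "\<dots> = (x * q * y) ^ s * (y ^ M * q ^ T M) *
            (q ^ (s * s + s * M) / (qpoch q q s * qpoch q q (s + M)))"
          unfolding TT by (simp add: power_add power_mult_distrib mult_ac)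
        also have "y ^ M * q ^ T M = x powi j * q powi e j"
          using x q0 by (simp add: j e_neg y_def power_int_diff power_int_minus power_divide
              power_mult_distrib field_simps)
        finally show ?thesis
          using x q0 by (simp add: j y_def)
      qed
    qed
    show "((\<lambda>s. case (j, s) of (j, s) \<Rightarrow> E x (s + nat j) * E y (s + nat (- j))) has_sum
        x powi j * q powi e j * (1 / qpoch_inf q q)) UNIV"
      unfolding prod.case term_eq by (rule has_sum_cmult_right[OF cauchy_has_sum[OF q]])
  qed
  from has_sum_cmult_right[OF this, of "qpoch_inf q q"] show ?thesis
    using qpoch_inf_self_nonzero[OF q] by (simp add: e_def mult.assoc)
qed

lemma norm_inv_qpoch_bound:
  obtains C where "C > 0" "\<And>a. norm (inv_qpoch q a) \<le> C"
proof -
  obtain C where "C > 0" "\<And>n. norm (inverse (qpoch q q n)) \<le> C"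
    using inverse_qpoch_bound[OF q] by blast
  then show ?thesis
    by (intro that[of C]) (auto simp: inv_qpoch_def)
qed

text \<open>One absolutely convergent double series is summed in both orders: over i first it gives
  the closed form of \<open>even_sum\<close>, over n first it gives Cauchy's sum. The common value X
  links the two.\<close>

theorem bailey_sum:
  obtains X where
    "((\<lambda>n. q ^ (n * n) * (q ^ T n * qpoch (- q) q n / qpoch q q (2 * n + 1))) has_sum X) UNIV"
    "((\<lambda>i. (- 1) powi i * q powi (5 * (i * i) + i) / qpoch_inf q q) has_sum X) UNIV"
proof -
  define F where "F i n = q ^ (n * n + n) * even_term q (- 1) (2 * int n + 1) (int n) i" for i n
  obtain C where C: "C > 0" "\<And>a. norm (inv_qpoch q a) \<le> C"
    using norm_inv_qpoch_bound by blast
  \<comment> \<open>A nonzero term forces |i| <= n, so q^(n^2+n) provides decay in both i and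
    n.\<close>
  have bound: "norm (F i n) \<le> C * C * (norm q ^ nat \<bar>i\<bar> * norm q ^ n)" for i n
  proof (cases "\<bar>i\<bar> \<le> int n")
    case True
    have "0 \<le> i * (i - 1)"
      by (cases "i \<le> 0") (auto intro: mult_nonpos_nonpos)
    then have "norm (q powi (i * i + - 1 * i)) \<le> 1"
      using q by (simp add: norm_power power_int_def right_diff_distrib power_le_one)
    then have "norm (even_term q (- 1) (2 * int n + 1) (int n) i) \<le> 1 * C * C"
      unfolding even_term_def norm_mult using C
      by (intro mult_mono) (auto simp: norm_power_int less_imp_le)
    moreover have "nat \<bar>i\<bar> + n \<le> n * n + n"
      using True le_square[of n] by linarith
    then have "norm q ^ (n * n + n) \<le> norm q ^ (nat \<bar>i\<bar> + n)"
      using q by (intro power_decreasing) auto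
    ultimately have "norm q ^ (n * n + n) * norm (even_term q (- 1) (2 * int n + 1) (int n) i)
        \<le> norm q ^ (nat \<bar>i\<bar> + n) * (1 * C * C)"
      by (intro mult_mono) auto
    then show ?thesis
      by (simp add: F_def norm_mult norm_power power_add mult_ac)
  next
    case False
    then have "F i n = 0"
      unfolding F_def by (subst even_term_zero) auto
    then show ?thesis
      using C by simp
  qed
  have "(\<lambda>(i, n). C * C * (norm q ^ nat \<bar>i\<bar> * norm q ^ n)) summable_on UNIV \<times> UNIV"
    using summable_on_cmult_right[OF summable_on_nonneg_times[OF summable_on_power_abs_int
          summable_on_power_nat], of "norm q" "norm q" "C * C"] q
    by (simp add: case_prod_unfold)
  then have "(\<lambda>p. norm (case p of (i, n) \<Rightarrow> F i n)) summable_on UNIV \<times> UNIV"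
    by (rule Infinite_Sum.abs_summable_on_comparison_test') (use bound in auto)
  then have "(\<lambda>(i, n). F i n) summable_on UNIV \<times> UNIV"
    by (rule abs_summable_summable)
  then obtain X where X: "((\<lambda>(i, n). F i n) has_sum X) (UNIV \<times> UNIV)"
    by (auto simp: summable_on_def)
  have "((\<lambda>n. q ^ (n * n) * (q ^ n * even_sum q (- 1) (2 * int n + 1) (int n))) has_sum X) UNIV"
  proof (rule has_sum_SigmaD)
    show "((\<lambda>(n, i). F i n) has_sum X) (UNIV \<times> UNIV)"
      using X by (subst (asm) has_sum_swap) simp
    fix n :: nat
    have "((\<lambda>i. F i n) has_sum q ^ (n * n + n) * even_sum q (- 1) (2 * int n + 1) (int n)) UNIV"
      unfolding F_def even_sum_def by (intro has_sum_cmult_right has_sum_infsum even_term_summable)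
    then show "((\<lambda>i. case (n, i) of (n, i) \<Rightarrow> F i n) has_sum
        q ^ (n * n) * (q ^ n * even_sum q (- 1) (2 * int n + 1) (int n))) UNIV"
      by (simp add: power_add mult.assoc)
  qed
  moreover have "((\<lambda>i. (- 1) powi i * q powi (5 * (i * i) + i) / qpoch_inf q q) has_sum X) UNIV"
  proof (rule has_sum_SigmaD[OF X])
    fix i :: int
    \<comment> \<open>The smallest n at which both indices n - 2i and n + 1 + 2i are nonnegative.
      They are n - J and n + J + 1 in some order, so n = s + J gives Cauchy's sum with M = 2J +
      1.\<close>
    define J where "J = nat (if i \<ge> 0 then 2 * i else - 1 - 2 * i)"
    define c where "c = (- 1) powi i * q powi (5 * (i * i) + i)"
    have J: "int J = (if i \<ge> 0 then 2 * i else - 1 - 2 * i)"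
      by (simp add: J_def)
    \<comment> \<open>For either sign of i, J^2 + J = 4 i^2 + 2i.\<close>
    have exp_J: "i * i + - 1 * i + int (J * J + J) = 5 * (i * i) + i"
      by (simp add: J algebra_simps)
    have "F i (s + J) = c * (q ^ (s * s + s * (2 * J + 1)) / (qpoch q q s * qpoch q q (s + (2 * J + 1))))" for s
    proof -
      define n where "n = s + J"
      have "inv_qpoch q (int n - 2 * i) * inv_qpoch q (2 * int n + 1 - int n + 2 * i)
          = 1 / (qpoch q q s * qpoch q q (s + (2 * J + 1)))"
      proof (cases "i \<ge> 0")
        case True
        then have "int n - 2 * i = int s" "2 * int n + 1 - int n + 2 * i = int (s + (2 * J + 1))"
          using J by (simp_all add: n_def)
        then show ?thesis
          by (simp only: inv_qpoch_def nat_int) (simp add: field_simps)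
      next
        case False
        then have "int n - 2 * i = int (s + (2 * J + 1))" "2 * int n + 1 - int n + 2 * i = int s"
          using J by (simp_all add: n_def)
        then show ?thesis
          by (simp only: inv_qpoch_def nat_int) (simp add: field_simps)
      qed
      moreover have "q powi (i * i + - 1 * i) * q ^ (n * n + n)
          = q powi (5 * (i * i) + i) * q ^ (s * s + s * (2 * J + 1))"
      proof -
        have "n * n + n = (J * J + J) + (s * s + s * (2 * J + 1))"
          by (simp add: n_def algebra_simps)
        then show ?thesis
          unfolding exp_J[symmetric] using q0
          by (simp only: power_add power_int_add power_int_of_nat simp_thms mult.assoc)
      qed
      moreover have "F i n = (- 1) powi i * (q powi (i * i + - 1 * i) * q ^ (n * n + n)) *
          (inv_qpoch q (int n - 2 * i) * inv_qpoch q (2 * int n + 1 - int n + 2 * i))"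
        unfolding F_def even_term_def by (simp only: mult_ac)
      ultimately have "F i n = (- 1) powi i * (q powi (5 * (i * i) + i) * q ^ (s * s + s * (2 * J + 1)))
          * (1 / (qpoch q q s * qpoch q q (s + (2 * J + 1))))"
        by (simp only:)
      then show ?thesis
        by (simp add: n_def c_def)
    qed
    then have "((\<lambda>s. F i (s + J)) has_sum c * (1 / qpoch_inf q q)) UNIV"
      using has_sum_cmult_right[OF cauchy_has_sum[OF q]] by (simp only:)
    moreover have "bij_betw (\<lambda>s. s + J) UNIV {J..}"
      by (rule bij_betw_byWitness[where f' = "\<lambda>n. n - J"]) auto
    ultimately have "(F i has_sum c * (1 / qpoch_inf q q)) {J..}"
      by (simp add: has_sum_reindex_bij_betw[of "\<lambda>s. s + J" UNIV "{J..}" "F i"])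
    then have "(F i has_sum c * (1 / qpoch_inf q q)) UNIV"
    proof (rule has_sum_cong_neutral[THEN iffD1, rotated -1])
      fix n assume "n \<in> UNIV - {J..}"
      then have "2 * i < int n - (2 * int n + 1) \<or> 2 * i > int n"
        using J by (auto split: if_splits)
      then show "F i n = 0"
        by (simp add: F_def even_term_zero)
    qed auto
    then show "((\<lambda>n. case (i, n) of (i, n) \<Rightarrow> F i n) has_sum
        (- 1) powi i * q powi (5 * (i * i) + i) / qpoch_inf q q) UNIV"
      by (simp add: c_def)
  qed
  ultimately show ?thesis
    unfolding even_sum_eq[OF q q0] by (rule that)
qed

end

section \<open>The double sum\<close>

lemma qpoch_minus_mult: "qpoch (- q) q n * qpoch q q n = qpoch (q ^ 2) (q ^ 2) n"
  by (simp add: qpoch_def power2_eq_square algebra_simps flip: prod.distrib power_mult_distrib)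

lemma qpoch_inf_minus_mult:
  assumes "norm q < 1"
  shows "qpoch_inf (- q) q * qpoch_inf q q = qpoch_inf (q ^ 2) (q ^ 2)"
proof (rule LIMSEQ_unique)
  show "(\<lambda>n. qpoch (- q) q n * qpoch q q n) \<longlonglongrightarrow> qpoch_inf (- q) q * qpoch_inf q q"
    by (intro tendsto_intros qpoch_tendsto assms)
  have "norm (q ^ 2) < 1"
    using assms by (simp add: norm_power power_less_one_iff)
  then show "(\<lambda>n. qpoch (- q) q n * qpoch q q n) \<longlonglongrightarrow> qpoch_inf (q ^ 2) (q ^ 2)"
    unfolding qpoch_minus_mult by (rule qpoch_tendsto)
qed

context
  fixes q :: complex
  assumes q: "norm q < 1"
begin

lemma norm_sq: "norm (q ^ 2) < 1"
  using q by (simp add: norm_power power_less_one_iff)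

section \<open>Absolute convergence of the double sums\<close>

lemma summable_on_geometric_bound:
  fixes f :: "nat \<times> nat \<Rightarrow> complex"
  assumes "\<And>m k. norm (f (m, k)) \<le> C * norm q ^ (m + k)"
  shows "f summable_on UNIV"
proof -
  have "(\<lambda>(m, k). C * (norm q ^ m * norm q ^ k)) summable_on UNIV \<times> UNIV"
    using summable_on_cmult_right[OF summable_on_nonneg_times[OF summable_on_power_nat
          summable_on_power_nat], of "norm q" "norm q" C] q
    by (simp add: case_prod_unfold)
  then have "(\<lambda>p. norm (f p)) summable_on UNIV \<times> UNIV"
    by (rule Infinite_Sum.abs_summable_on_comparison_test') (use assms in \<open>auto simp: power_add\<close>)
  then show ?thesis
    using abs_summable_summable by simp
qed

lemma double_sum_summable:
  "(\<lambda>(m, k). q ^ (T m + T (m + k)) * qpoch (- q) (q ^ 2) (k div 2)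
      / (qpoch q q m * qpoch q q k)) summable_on UNIV"
proof -
  obtain C where C: "C > 0" "\<And>n. norm (inverse (qpoch q q n)) \<le> C"
    using inverse_qpoch_bound[OF q] by blast
  obtain D where D: "D > 0" "\<And>n. norm (qpoch (- q) (q ^ 2) n) \<le> D"
    using qpoch_bound[OF norm_sq] by blast
  show ?thesis
  proof (rule summable_on_geometric_bound[of _ "D * C * C"])
    fix m k
    have "norm q ^ (T m + T (m + k)) * norm (qpoch (- q) (q ^ 2) (k div 2))
        * norm (inverse (qpoch q q m)) * norm (inverse (qpoch q q k)) \<le> norm q ^ (m + k) * D * C * C"
      using q C D T_ge[of "m + k"] by (intro mult_mono power_decreasing) (auto simp: less_imp_le)
    then show "norm (case (m, k) of (m, k) \<Rightarrow> q ^ (T m + T (m + k)) * qpoch (- q) (q ^ 2) (k div 2)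
        / (qpoch q q m * qpoch q q k)) \<le> D * C * C * norm q ^ (m + k)"
      by (simp add: norm_mult norm_divide norm_power norm_inverse field_simps)
  qed
qed

lemma lowered_double_sum_summable:
  "(\<lambda>(l, s). q ^ T (l + s) * (lowered_coeff q l / qpoch q q s)) summable_on UNIV"
proof -
  obtain C where C: "C > 0" "\<And>n. norm (inverse (qpoch q q n)) \<le> C"
    using inverse_qpoch_bound[OF q] by blast
  obtain D where D: "D > 0" "\<And>n. norm (qpoch (- (q ^ 2)) (q ^ 2) n) \<le> D"
    using qpoch_bound[OF norm_sq] by blast
  have w: "norm (lowered_coeff q l) \<le> 1 * D * C" for l
    unfolding lowered_coeff_def divide_inverse norm_mult norm_power
    using q C D by (intro mult_mono power_le_one) (auto simp: less_imp_le)
  show ?thesis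
  proof (rule summable_on_geometric_bound[of _ "D * C * C"])
    fix l s
    have "norm q ^ T (l + s) * (norm (lowered_coeff q l) * norm (inverse (qpoch q q s)))
        \<le> norm q ^ (l + s) * ((1 * D * C) * C)"
      using q C D T_ge[of "l + s"] w by (intro mult_mono power_decreasing) (auto simp: less_imp_le)
    then show "norm (case (l, s) of (l, s) \<Rightarrow> q ^ T (l + s) * (lowered_coeff q l / qpoch q q s))
        \<le> D * C * C * norm q ^ (l + s)"
      by (simp add: norm_mult norm_divide norm_power norm_inverse field_simps)
  qed
qed

lemma qpoch_minus_nonzero: "qpoch (- q) q n \<noteq> 0"
  using qpoch_self_nonzero[OF norm_sq, of n] unfolding qpoch_minus_mult[symmetric] by simp

text \<open>On an antidiagonal m + k = N the factor q^T(N) is constant, so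
  \<open>qexp_convolution\<close> replaces the inner sum. For fixed l, Euler's theorem at q^l then
  sums over s, and the terms 2n and 2n + 1 are combined.\<close>

lemma double_sum_eq_single_sum:
  assumes q0: "q \<noteq> 0"
    and S: "((\<lambda>(m, k). q ^ (T m + T (m + k)) * qpoch (- q) (q ^ 2) (k div 2)
      / (qpoch q q m * qpoch q q k)) has_sum S) UNIV"
  shows "((\<lambda>n. qpoch_inf (- q) q * ((q ^ 2) ^ (n * n) * ((q ^ 2) ^ T n * qpoch (- (q ^ 2)) (q ^ 2) n
      / qpoch (q ^ 2) (q ^ 2) (2 * n + 1)))) has_sum S) UNIV"
proof -
  define g where "g = (\<lambda>(l, s). q ^ T (l + s) * (lowered_coeff q l / qpoch q q s))"
  obtain S' where S': "(g has_sum S') UNIV"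
    using lowered_double_sum_summable unfolding g_def summable_on_def by blast
  have "(\<Sum>m\<le>N. q ^ (T m + T (m + (N - m))) * qpoch (- q) (q ^ 2) ((N - m) div 2)
      / (qpoch q q m * qpoch q q (N - m))) = (\<Sum>l\<le>N. g (l, N - l))" for N
  proof -
    have "(\<Sum>m\<le>N. q ^ (T m + T (m + (N - m))) * qpoch (- q) (q ^ 2) ((N - m) div 2)
        / (qpoch q q m * qpoch q q (N - m)))
      = q ^ T N * (\<Sum>m\<le>N. q ^ T m / qpoch q q m * (qpoch (- q) (q ^ 2) ((N - m) div 2) / qpoch q q (N - m)))"
      unfolding sum_distrib_left by (intro sum.cong) (auto simp: power_add)
    also have "\<dots> = (\<Sum>l\<le>N. g (l, N - l))"
      unfolding qexp_convolution[OF q q0] sum_distrib_left by (intro sum.cong) (auto simp: g_def)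
    finally show ?thesis .
  qed
  then have "S = S'"
    using has_sum_antidiagonal[OF S] has_sum_antidiagonal[OF S'] has_sum_unique by fastforce
  define h where "h l = lowered_coeff q l * q ^ T l / qpoch (- q) q l * qpoch_inf (- q) q" for l
  have "(g has_sum S) (UNIV \<times> UNIV)"
    using S' \<open>S = S'\<close> by simp
  then have "(h has_sum S) UNIV"
  proof (rule has_sum_SigmaD)
    fix l
    have "((\<lambda>s. lowered_coeff q l * q ^ T l * (q ^ T s / qpoch q q s * (q ^ l) ^ s)) has_sum
        lowered_coeff q l * q ^ T l * qpoch_inf (- (q ^ l) * q) q) UNIV"
      by (rule has_sum_cmult_right[OF euler_has_sum[OF q]])
    moreover have "qpoch_inf (- (q ^ l) * q) q = qpoch_inf (- q) q / qpoch (- q) q l"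
      using qpoch_inf_split[OF q, of "- q" l] qpoch_minus_nonzero[of l] by (simp add: mult.commute)
    moreover have "g (l, s) = lowered_coeff q l * q ^ T l * (q ^ T s / qpoch q q s * (q ^ l) ^ s)" for s
      by (simp add: g_def T_add power_add power_mult)
    ultimately show "((\<lambda>s. g (l, s)) has_sum h l) UNIV"
      by (simp add: h_def)
  qed
  then have "((\<lambda>n. h (2 * n) + h (2 * n + 1)) has_sum S) UNIV"
    by (rule has_sum_pairs)
  moreover have "h (2 * n) + h (2 * n + 1) = qpoch_inf (- q) q * ((q ^ 2) ^ (n * n) * ((q ^ 2) ^ T n
      * qpoch (- (q ^ 2)) (q ^ 2) n / qpoch (q ^ 2) (q ^ 2) (2 * n + 1)))" for n
  proof -
    define Q where "Q = q ^ 2"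
    \<comment> \<open>The terms at 2n and 2n + 1 become c (1 - Q^(2n+1)) and c Q^(2n+1), both over
      (Q;Q)_{2n+1}; their sum is c/(Q;Q)_{2n+1}.\<close>
    define c where "c = qpoch_inf (- q) q * qpoch (- Q) Q n * q ^ (n * n + T (2 * n))"
    have P: "qpoch q q m * qpoch (- q) q m = qpoch Q Q m" for m
      unfolding Q_def using qpoch_minus_mult[of q m] by (simp only: mult.commute)
    have "h (2 * n) = c / (qpoch q q (2 * n) * qpoch (- q) q (2 * n))"
      by (simp add: h_def lowered_coeff_def c_def Q_def power_add power2_eq_square mult_ac)
    then have h0: "h (2 * n) = c / qpoch Q Q (2 * n)"
      unfolding P .
    have "h (2 * n + 1) = c * Q ^ Suc (2 * n) / (qpoch q q (2 * n + 1) * qpoch (- q) q (2 * n + 1))"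
    proof -
      have "n * n + (2 * n + 1) + T (2 * n + 1) = n * n + T (2 * n) + 2 * Suc (2 * n)"
        by (simp add: T_Suc)
      then have e: "q ^ (n * n + (2 * n + 1)) * q ^ T (2 * n + 1) = q ^ (n * n + T (2 * n)) * Q ^ Suc (2 * n)"
        unfolding Q_def by (metis power_add power_mult)
      have "h (2 * n + 1) = (q ^ (n * n + (2 * n + 1)) * q ^ T (2 * n + 1))
          * (qpoch_inf (- q) q * qpoch (- Q) Q n) / (qpoch q q (2 * n + 1) * qpoch (- q) q (2 * n + 1))"
        by (simp add: h_def lowered_coeff_def Q_def power2_eq_square mult_ac)
      then show ?thesis
        unfolding e by (simp add: c_def mult_ac)
    qed
    then have h1: "h (2 * n + 1) = c * Q ^ Suc (2 * n) / qpoch Q Q (Suc (2 * n))"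
      unfolding P by simp
    have "h (2 * n) = c / qpoch Q Q (Suc (2 * n)) * (1 - Q ^ Suc (2 * n))"
      unfolding h0 Q_def by (rule div_qpoch_self_Suc[OF norm_sq, symmetric])
    then have "h (2 * n) + h (2 * n + 1) = c / qpoch Q Q (Suc (2 * n))"
      unfolding h1 by (simp add: right_diff_distrib)
    moreover have "n * n + T (2 * n) = 2 * (n * n) + 2 * T n"
      using two_T[of n] two_T[of "2 * n"] by simp
    then have "q ^ (n * n + T (2 * n)) = Q ^ (n * n) * Q ^ T n"
      unfolding Q_def by (metis power_add power_mult)
    ultimately show ?thesis
      unfolding Q_def[symmetric] by (simp add: c_def mult_ac)
  qed
  ultimately show ?thesis
    by (simp only:)
qed

lemma double_sum_value:
  assumes q0: "q \<noteq> 0"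
    and S: "((\<lambda>(m, k). q ^ (T m + T (m + k)) * qpoch (- q) (q ^ 2) (k div 2)
      / (qpoch q q m * qpoch q q k)) has_sum S) UNIV"
  shows "S = qpoch_inf_list [q ^ 20, q ^ 8, q ^ 12] (q ^ 20) / qpoch_inf q q"
proof -
  define Q where "Q = q ^ 2"
  define R where "R = q ^ 20"
  have Q: "norm Q < 1" "Q \<noteq> 0" and R: "norm R < 1" "R \<noteq> 0"
    using q q0 by (auto simp: Q_def R_def norm_power power_less_one_iff)
  obtain X where
    X1: "((\<lambda>n. Q ^ (n * n) * (Q ^ T n * qpoch (- Q) Q n / qpoch Q Q (2 * n + 1))) has_sum X) UNIV"
    and X2: "((\<lambda>i. (- 1) powi i * Q powi (5 * (i * i) + i) / qpoch_inf Q Q) has_sum X) UNIV"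
    using bailey_sum[OF Q] by blast
  have S_eq: "S = qpoch_inf (- q) q * X"
    using double_sum_eq_single_sum[OF q0 S] has_sum_cmult_right[OF X1, of "qpoch_inf (- q) q"]
      has_sum_unique unfolding Q_def by blast
  have X_eq: "X = qpoch_inf_list [q ^ 20, q ^ 8, q ^ 12] (q ^ 20) / qpoch_inf Q Q"
  proof -
    \<comment> \<open>Chosen so that x^j R^((j^2+j)/2) has exponent -8j + 10(j^2 + j) = 2(5j^2 + j)
      in q, while -xR and -1/x become q^12 and q^8.\<close>
    define x where "x = - inverse (q ^ 8)"
    have x: "x \<noteq> 0" "- x * R = q ^ 12" "- 1 / x = q ^ 8"
      using q0 by (simp_all add: x_def R_def field_simps flip: power_add)
    have "x powi j * R powi ((j * j + j) div 2) = (- 1) powi j * Q powi (5 * (j * j) + j)" for j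
    proof -
      have e: "2 * ((j * j + j) div 2) = j * j + j"
        by simp
      have "R powi ((j * j + j) div 2) = q powi (20 * ((j * j + j) div 2))"
        unfolding R_def power_int_mult by simp
      also have "20 * ((j * j + j) div 2) = 10 * (j * j + j)"
      proof -
        have "20 * ((j * j + j) div 2) = 10 * (2 * ((j * j + j) div 2))"
          by (simp only: mult.assoc[symmetric])
        then show ?thesis
          unfolding e .
      qed
      finally have R': "R powi ((j * j + j) div 2) = q powi (10 * (j * j + j))" .
      have "x = - 1 * q powi (- 8)"
        by (simp add: x_def power_int_minus)
      then have "x powi j = (- 1) powi j * q powi (- 8 * j)"
        by (simp only: power_int_mult_distrib power_int_mult)
      moreover have "Q powi (5 * (j * j) + j) = q powi (2 * (5 * (j * j) + j))"
        unfolding Q_def power_int_mult[of q 2] by simp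
      moreover have "2 * (5 * (j * j) + j) = - 8 * j + 10 * (j * j + j)"
        by simp
      ultimately show ?thesis
        unfolding R' using q0 by (simp only: power_int_add simp_thms mult.assoc)
    qed
    then have "((\<lambda>j. (- 1) powi j * Q powi (5 * (j * j) + j)) has_sum
        qpoch_inf R R * qpoch_inf (q ^ 12) R * qpoch_inf (q ^ 8) R) UNIV"
      using jacobi_triple_product[OF R x(1)] unfolding x(2,3) by (simp only:)
    then have "((\<lambda>j. (- 1) powi j * Q powi (5 * (j * j) + j) / qpoch_inf Q Q) has_sum
        qpoch_inf R R * qpoch_inf (q ^ 12) R * qpoch_inf (q ^ 8) R / qpoch_inf Q Q) UNIV"
      unfolding divide_inverse by (rule has_sum_cmult_left)
    from has_sum_unique[OF X2 this] show ?thesis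
      by (simp add: qpoch_inf_list_def mult_ac flip: R_def)
  qed
  have prod_eq: "qpoch_inf (- q) q / qpoch_inf Q Q = 1 / qpoch_inf q q"
    using qpoch_inf_minus_mult[OF q] qpoch_inf_self_nonzero[OF q] qpoch_inf_self_nonzero[OF Q(1)]
    unfolding Q_def by (simp add: field_simps)
  have "S = qpoch_inf_list [q ^ 20, q ^ 8, q ^ 12] (q ^ 20) * (qpoch_inf (- q) q / qpoch_inf Q Q)"
    unfolding S_eq X_eq by (simp add: mult.commute)
  then show ?thesis
    unfolding prod_eq by (simp only: times_divide_eq_right mult_1_right)
qed

end

theorem mainTheorem9:
  fixes q :: complex
  assumes "norm q < 1"
  shows "((\<lambda>(m, k). q ^ (T m + T (m + k)) * qpoch (- q) (q ^ 2) (k div 2)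
              / (qpoch q q m * qpoch q q k))
          has_sum (qpoch_inf_list [q ^ 20, q ^ 8, q ^ 12] (q ^ 20) / qpoch_inf q q))
         (UNIV :: (nat \<times> nat) set)"
proof (cases "q = 0")
  case False
  obtain S where S: "((\<lambda>(m, k). q ^ (T m + T (m + k)) * qpoch (- q) (q ^ 2) (k div 2)
      / (qpoch q q m * qpoch q q k)) has_sum S) UNIV"
    using double_sum_summable[OF assms] unfolding summable_on_def by blast
  then show ?thesis
    using double_sum_value[OF assms False S] by simp
next
  case True
  let ?f = "\<lambda>(m, k). q ^ (T m + T (m + k)) * qpoch (- q) (q ^ 2) (k div 2) / (qpoch q q m * qpoch q q k)"
  \<comment> \<open>At q = 0 only the term (0, 0) survives, because T(m + k) > 0 elsewhere; both
    sides are 1.\<close>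
  have "(?f has_sum (\<Sum>p\<in>{(0, 0)}. ?f p)) UNIV"
  proof (rule has_sum_finite_neutralI)
    fix p :: "nat \<times> nat" assume p: "p \<in> UNIV - {(0, 0)}"
    obtain m k where mk: "p = (m, k)"
      by (cases p)
    have "T (m + k) > 0"
      using p mk T_ge[of "m + k"] by auto
    then show "?f p = 0"
      using True mk by simp
  qed auto
  then show ?thesis
    using True by (simp add: qpoch_inf_list_def qpoch_inf_def)
qed

end
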